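(* Let $\mathbb{K}$ be a field, $d\ge 0$ an integer, $\mathcal{A}$ a $\mathbb{K}$-algebra isomorphic to $\mathrm{Mat}_{d+1}(\mathbb{K})$, and let $\Phi=(A;\{E_i\}_{i=0}^d;A^*;\{E^*_i\}_{i=0}^d)$ be a Leonard system in $\mathcal{A}$ with parameter array $(\{\theta_i\}_{i=0}^d;\{\theta^*_i\}_{i=0}^d;\{\varphi_i\}_{i=1}^d;\{\phi_i\}_{i=1}^d)$. Let $\tau_i,\eta_i,\tau^*_i,\eta^*_i$ $(0\le i\le d)$ be the polynomials attached to $\Phi$. Then all of the following hold: $$E_0E^*_dE_dE^*_0=\frac{\varphi_1\varphi_2\cdots\varphi_d}{\tau_d(\theta_d)\tau^*_d(\theta^*_d)}E_0E^*_0,\qquad E_0E^*_0E_dE^*_d=\frac{\phi_1\phi_2\cdots\phi_d}{\tau_d(\theta_d)\eta^*_d(\theta^*_0)}E_0E^*_d,$$ $$E_dE^*_dE_0E^*_0=\frac{\phi_1\phi_2\cdots\phi_d}{\eta_d(\theta_0)\tau^*_d(\theta^*_d)}E_dE^*_0,\qquad E_dE^*_0E_0E^*_d=\frac{\varphi_1\varphi_2\cdots\varphi_d}{\eta_d(\theta_0)\eta^*_d(\theta^*_0)}E_dE^*_d,$$ $$E^*_0E_dE^*_dE_0=\frac{\varphi_1\varphi_2\cdots\varphi_d}{\tau_d(\theta_d)\tau^*_d(\theta^*_d)}E^*_0E_0,\qquad E^*_0E_0E^*_dE_d=\frac{\phi_1\phi_2\cdots\phi_d}{\eta_d(\theta_0)\tau^*_d(\theta^*_d)}E^*_0E_d,$$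 $$E^*_dE_dE^*_0E_0=\frac{\phi_1\phi_2\cdots\phi_d}{\tau_d(\theta_d)\eta^*_d(\theta^*_0)}E^*_dE_0,\qquad E^*_dE_0E^*_0E_d=\frac{\varphi_1\varphi_2\cdots\varphi_d}{\eta_d(\theta_0)\eta^*_d(\theta^*_0)}E^*_dE_d.$$
   Context: Notation: $A^*$ is just the name of an element (not the conjugate-transpose of $A$). Empty products equal $1$. $V$ denotes a simple $\mathcal{A}$-module (unique up to isomorphism, of dimension $d+1$ over $\mathbb{K}$). Primitive idempotents. An element $A\in\mathcal{A}$ is multiplicity-free if it has $d+1$ mutually distinct eigenvalues in $\mathbb{K}$. If $\theta_0,\dots,\theta_d$ is an ordering of these eigenvalues, the primitive idempotent of $A$ associated with $\theta_i$ is $E_i=\prod_{0\le j\le d,\ j\ne i}\frac{A-\theta_jI}{\theta_i-\theta_j}$. Leonard system. A Leonard system in $\mathcal{A}$ is a sequence $\Phi=(A;\{E_i\}_{i=0}^d;A^*;\{E^*_i\}_{i=0}^d)$ such that: (i) $A,A^*\in\mathcal{A}$ are both multiplicity-free; (ii) $E_0,\dots,E_d$ is an ordering of the primitive idempotents of $A$; (iii) $E^*_0,\dots,E^*_d$ is an ordering of the primitive idempotents of $A^*$; (iv) for $0\le i,j\le d$, $E_iA^*E_j=0$ if $|i-j|>1$ and $E_iA^*E_j\neq0$ if $|i-j|=1$; (v) for $0\le i,j\le d$, $E^*_iAE^*_j=0$ if $|i-j|>1$ and $E^*_iAE^*_j\ne0$ if $|i-j|=1$. Parameter array. $\theta_i$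 is the eigenvalue of $A$ associated with $E_i$, and $\theta^*_i$ is the eigenvalue of $A^*$ associated with $E^*_i$. For $0\le i\le d$ put $U_i=(E^*_0V+\cdots+E^*_iV)\cap(E_iV+\cdots+E_dV)$. It is known that each $U_i$ is $1$-dimensional, $V=U_0\oplus\cdots\oplus U_d$, $(A-\theta_iI)U_i=U_{i+1}$ $(0\le i\le d-1)$, $(A-\theta_dI)U_d=0$, $(A^*-\theta^*_iI)U_i=U_{i-1}$ $(1\le i\le d)$, $(A^*-\theta^*_0I)U_0=0$. For $1\le i\le d$, $\varphi_i$ denotes the (nonzero) eigenvalue of $(A-\theta_{i-1}I)(A^*-\theta^*_iI)$ on $U_i$; $\varphi_1,\dots,\varphi_d$ is the first split sequence of $\Phi$. The sequence $\Phi^{\Downarrow}=(A;\{E_{d-i}\}_{i=0}^d;A^*;\{E^*_i\}_{i=0}^d)$ is also a Leonard system, and the second split sequence $\phi_1,\dots,\phi_d$ of $\Phi$ is the first split sequence of $\Phi^{\Downarrow}$; that is, $\phi_i$ is the (nonzero) eigenvalue of $(A-\theta_{d-i+1}I)(A^*-\theta^*_iI)$ on $(E^*_0V+\cdots+E^*_iV)\cap(E_{d-i}V+E_{d-i-1}V+\cdots+E_0V)$. The parameter array of $\Phi$ is $(\{\theta_i\}_{i=0}^d;\{\theta^*_i\}_{i=0}^d;\{\varphi_i\}_{i=1}^d;\{\phi_i\}_{i=1}^d)$. Polynomials. For $0\le i\le d$, in $\mathbb{K}[\lambda]$: $\tau_i=(\lambda-\theta_0)(\lambda-\theta_1)\cdots(\lambda-\theta_{i-1})$,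 $\eta_i=(\lambda-\theta_d)(\lambda-\theta_{d-1})\cdots(\lambda-\theta_{d-i+1})$, $\tau^*_i=(\lambda-\theta^*_0)(\lambda-\theta^*_1)\cdots(\lambda-\theta^*_{i-1})$, $\eta^*_i=(\lambda-\theta^*_d)(\lambda-\theta^*_{d-1})\cdots(\lambda-\theta^*_{d-i+1})$. *)

theory Defs
  imports
    "HOL-Library.Set_Algebras"
    "HOL-Computational_Algebra.Polynomial"
    "Jordan_Normal_Form.Matrix"
begin

section \<open>The ambient algebra and its simple module\<close>

text \<open>
  The locale \<open>algebra\<close> of HOL-Algebra is for commutative algebras only, so the
  ambient algebra is a unital ring with a scalar multiplication \<open>scale\<close>.
\<close>

locale assoc_algebra = vector_space scale
  for scale :: "'k::field \<Rightarrow> 'a::ring_1 \<Rightarrow> 'a" +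
  assumes scale_mult_left: "scale c x * y = scale c (x * y)"
    and scale_mult_right: "x * scale c y = scale c (x * y)"

locale full_matrix_algebra = assoc_algebra scale
  for scale :: "'k::field \<Rightarrow> 'a::ring_1 \<Rightarrow> 'a" and d :: nat +
  assumes iso_mat: "\<exists>f. bij_betw f UNIV (carrier_mat (d + 1) (d + 1))
      \<and> (\<forall>x y. f (x + y) = f x + f y)
      \<and> (\<forall>x y. f (x * y) = f x * f y)
      \<and> f 1 = 1\<^sub>m (d + 1)
      \<and> (\<forall>c x. f (scale c x) = c \<cdot>\<^sub>m f x)"

text \<open>
  The locale \<open>module\<close> of the library needs a commutative ring of scalars, hence
  this version for an arbitrary unital ring.
\<close>

locale left_module =
  fixes act :: "'a::ring_1 \<Rightarrow> 'v::ab_group_add \<Rightarrow> 'v"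
  assumes act_add_right: "act x (v + w) = act x v + act x w"
    and act_add_left: "act (x + y) v = act x v + act y v"
    and act_mult: "act (x * y) v = act x (act y v)"
    and act_one: "act 1 v = v"

definition submodule :: "('a \<Rightarrow> 'v::ab_group_add \<Rightarrow> 'v) \<Rightarrow> 'v set \<Rightarrow> bool" where
  "submodule act W \<longleftrightarrow>
     0 \<in> W \<and> (\<forall>v\<in>W. \<forall>w\<in>W. v + w \<in> W) \<and> (\<forall>x. \<forall>w\<in>W. act x w \<in> W)"

locale simple_left_module = left_module act
  for act :: "'a::ring_1 \<Rightarrow> 'v::ab_group_add \<Rightarrow> 'v" +
  assumes nonzero: "\<exists>v::'v. v \<noteq> 0"
    and simple: "submodule act W \<Longrightarrow> W = {0} \<or> W = UNIV"

section \<open>Eigenvalues and primitive idempotents\<close>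

text \<open>
  A scalar \<open>c\<close> acts on the module \<open>V\<close> as the algebra element \<open>scale c 1\<close> does.
  The eigenvalues of an algebra element are those of its action on \<open>V\<close>.
\<close>

definition eigenvalue_on ::
  "('k \<Rightarrow> 'a::ring_1 \<Rightarrow> 'a) \<Rightarrow> ('a \<Rightarrow> 'v::ab_group_add \<Rightarrow> 'v) \<Rightarrow> 'v set \<Rightarrow> 'a \<Rightarrow> 'k \<Rightarrow> bool" where
  "eigenvalue_on scale act W X c \<longleftrightarrow> (\<exists>w\<in>W. w \<noteq> 0 \<and> act X w = act (scale c 1) w)"

definition eigenvalues ::
  "('k \<Rightarrow> 'a::ring_1 \<Rightarrow> 'a) \<Rightarrow> ('a \<Rightarrow> 'v::ab_group_add \<Rightarrow> 'v) \<Rightarrow> 'a \<Rightarrow> 'k set" where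
  "eigenvalues scale act X = {c. eigenvalue_on scale act UNIV X c}"

definition multiplicity_free ::
  "('k \<Rightarrow> 'a::ring_1 \<Rightarrow> 'a) \<Rightarrow> ('a \<Rightarrow> 'v::ab_group_add \<Rightarrow> 'v) \<Rightarrow> nat \<Rightarrow> 'a \<Rightarrow> bool" where
  "multiplicity_free scale act d X \<longleftrightarrow> card (eigenvalues scale act X) = d + 1"

text \<open>
  The product is over a list because the algebra is not commutative; the factors
  commute with each other, so their order is immaterial.
\<close>

definition primitive_idempotent ::
  "('k::field \<Rightarrow> 'a::ring_1 \<Rightarrow> 'a) \<Rightarrow> nat \<Rightarrow> 'a \<Rightarrow> (nat \<Rightarrow> 'k) \<Rightarrow> nat \<Rightarrow> 'a" where
  "primitive_idempotent scale d X \<theta> i =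
     prod_list (map (\<lambda>j. scale (inverse (\<theta> i - \<theta> j)) (X - scale (\<theta> j) 1))
       (filter (\<lambda>j. j \<noteq> i) [0..<d + 1]))"

text \<open>
  \<open>idempotent_ordering scale act d X E \<theta>\<close>: \<open>\<theta> 0, \<dots>, \<theta> d\<close> is an ordering of the
  eigenvalues of \<open>X\<close>, and each \<open>E i\<close> is the primitive idempotent of \<open>X\<close> associated
  with \<open>\<theta> i\<close>. Here and below, values of sequences at indices greater than \<open>d\<close> play
  no role.
\<close>

definition idempotent_ordering ::
  "('k::field \<Rightarrow> 'a::ring_1 \<Rightarrow> 'a) \<Rightarrow> ('a \<Rightarrow> 'v::ab_group_add \<Rightarrow> 'v) \<Rightarrow> nat
    \<Rightarrow> 'a \<Rightarrow> (nat \<Rightarrow> 'a) \<Rightarrow> (nat \<Rightarrow> 'k) \<Rightarrow> bool" where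
  "idempotent_ordering scale act d X E \<theta> \<longleftrightarrow>
     bij_betw \<theta> {0..d} (eigenvalues scale act X) \<and>
     (\<forall>i\<le>d. E i = primitive_idempotent scale d X \<theta> i)"

section \<open>Leonard systems and their parameter arrays\<close>

definition leonard_system ::
  "('k::field \<Rightarrow> 'a::ring_1 \<Rightarrow> 'a) \<Rightarrow> ('a \<Rightarrow> 'v::ab_group_add \<Rightarrow> 'v) \<Rightarrow> nat
    \<Rightarrow> 'a \<Rightarrow> (nat \<Rightarrow> 'a) \<Rightarrow> 'a \<Rightarrow> (nat \<Rightarrow> 'a) \<Rightarrow> bool" where
  "leonard_system scale act d A E As Es \<longleftrightarrow>
     multiplicity_free scale act d A \<and>
     multiplicity_free scale act d As \<and>
     (\<exists>\<theta>. idempotent_ordering scale act d A E \<theta>) \<and>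
     (\<exists>\<theta>s. idempotent_ordering scale act d As Es \<theta>s) \<and>
     (\<forall>i\<le>d. \<forall>j\<le>d.
        (\<bar>int i - int j\<bar> > 1 \<longrightarrow> E i * As * E j = 0) \<and>
        (\<bar>int i - int j\<bar> = 1 \<longrightarrow> E i * As * E j \<noteq> 0)) \<and>
     (\<forall>i\<le>d. \<forall>j\<le>d.
        (\<bar>int i - int j\<bar> > 1 \<longrightarrow> Es i * A * Es j = 0) \<and>
        (\<bar>int i - int j\<bar> = 1 \<longrightarrow> Es i * A * Es j \<noteq> 0))"

text \<open>
  The space \<open>U\<^sub>i\<close>; the sums are sums of subspaces (pointwise sums of sets), and
  \<open>range (act (E j))\<close> is \<open>E\<^sub>j V\<close>.
\<close>

definition split_space ::
  "('a \<Rightarrow> 'v::ab_group_add \<Rightarrow> 'v) \<Rightarrow> nat \<Rightarrow> (nat \<Rightarrow> 'a) \<Rightarrow> (nat \<Rightarrow> 'a) \<Rightarrow> nat \<Rightarrow> 'v set" where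
  "split_space act d E Es i =
     (\<Sum>j=0..i. range (act (Es j))) \<inter> (\<Sum>j=i..d. range (act (E j)))"

definition first_split_sequence ::
  "('k::field \<Rightarrow> 'a::ring_1 \<Rightarrow> 'a) \<Rightarrow> ('a \<Rightarrow> 'v::ab_group_add \<Rightarrow> 'v) \<Rightarrow> nat
    \<Rightarrow> 'a \<Rightarrow> (nat \<Rightarrow> 'a) \<Rightarrow> 'a \<Rightarrow> (nat \<Rightarrow> 'a)
    \<Rightarrow> (nat \<Rightarrow> 'k) \<Rightarrow> (nat \<Rightarrow> 'k) \<Rightarrow> (nat \<Rightarrow> 'k) \<Rightarrow> bool" where
  "first_split_sequence scale act d A E As Es \<theta> \<theta>s \<phi> \<longleftrightarrow>
     (\<forall>i\<in>{1..d}. eigenvalue_on scale act (split_space act d E Es i)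
        ((A - scale (\<theta> (i - 1)) 1) * (As - scale (\<theta>s i) 1)) (\<phi> i))"

text \<open>
  The second split sequence is the first split sequence of the Leonard system
  obtained by reversing the order of the \<open>E i\<close>, and with them that of the \<open>\<theta> i\<close>.
\<close>

definition second_split_sequence ::
  "('k::field \<Rightarrow> 'a::ring_1 \<Rightarrow> 'a) \<Rightarrow> ('a \<Rightarrow> 'v::ab_group_add \<Rightarrow> 'v) \<Rightarrow> nat
    \<Rightarrow> 'a \<Rightarrow> (nat \<Rightarrow> 'a) \<Rightarrow> 'a \<Rightarrow> (nat \<Rightarrow> 'a)
    \<Rightarrow> (nat \<Rightarrow> 'k) \<Rightarrow> (nat \<Rightarrow> 'k) \<Rightarrow> (nat \<Rightarrow> 'k) \<Rightarrow> bool" where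
  "second_split_sequence scale act d A E As Es \<theta> \<theta>s \<phi> \<longleftrightarrow>
     first_split_sequence scale act d A (\<lambda>i. E (d - i)) As Es (\<lambda>i. \<theta> (d - i)) \<theta>s \<phi>"

text \<open>In \<open>parameter_array\<close>, \<open>\<phi>1\<close> and \<open>\<phi>2\<close> are the first and the second split sequence.\<close>

definition parameter_array ::
  "('k::field \<Rightarrow> 'a::ring_1 \<Rightarrow> 'a) \<Rightarrow> ('a \<Rightarrow> 'v::ab_group_add \<Rightarrow> 'v) \<Rightarrow> nat
    \<Rightarrow> 'a \<Rightarrow> (nat \<Rightarrow> 'a) \<Rightarrow> 'a \<Rightarrow> (nat \<Rightarrow> 'a)
    \<Rightarrow> (nat \<Rightarrow> 'k) \<Rightarrow> (nat \<Rightarrow> 'k) \<Rightarrow> (nat \<Rightarrow> 'k) \<Rightarrow> (nat \<Rightarrow> 'k) \<Rightarrow> bool" where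
  "parameter_array scale act d A E As Es \<theta> \<theta>s \<phi>1 \<phi>2 \<longleftrightarrow>
     idempotent_ordering scale act d A E \<theta> \<and>
     idempotent_ordering scale act d As Es \<theta>s \<and>
     first_split_sequence scale act d A E As Es \<theta> \<theta>s \<phi>1 \<and>
     second_split_sequence scale act d A E As Es \<theta> \<theta>s \<phi>2"

text \<open>The starred polynomials are \<open>tau \<theta>s i\<close> and \<open>eta d \<theta>s i\<close>.\<close>

definition tau :: "(nat \<Rightarrow> 'k::field) \<Rightarrow> nat \<Rightarrow> 'k poly" where
  "tau \<theta> i = (\<Prod>j<i. [:- \<theta> j, 1:])"

definition eta :: "nat \<Rightarrow> (nat \<Rightarrow> 'k::field) \<Rightarrow> nat \<Rightarrow> 'k poly" where
  "eta d \<theta> i = (\<Prod>j<i. [:- \<theta> (d - j), 1:])"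

end

theory Submission
  imports Defs
begin

text \<open>
  Let \<open>v\<close> span \<open>E\<^sup>*\<^sub>0 V\<close> and let \<open>u\<^sub>i = \<tau>\<^sub>i(A) v\<close>. The two flags
  \<open>E\<^sup>*\<^sub>0 V + \<dots> + E\<^sup>*\<^sub>i V\<close> and \<open>E\<^sub>i V + \<dots> + E\<^sub>d V\<close> are opposite to each other
  (\<open>flags_opposite\<close>), so \<open>u\<^sub>i\<close> spans \<open>U\<^sub>i\<close> (\<open>split_space_spanned\<close>). Hence \<open>A\<close> sends
  \<open>u\<^sub>i\<close> to \<open>\<theta>\<^sub>i u\<^sub>i + u\<^bsub>i+1\<^esub>\<close> and \<open>A\<^sup>*\<close> sends it to
  \<open>\<theta>\<^sup>*\<^sub>i u\<^sub>i + \<phi>\<^sub>i u\<^bsub>i-1\<^esub>\<close>, where \<open>\<phi>\<close> is the first split sequence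
  (\<open>split_vector_lowering\<close>); here \<open>u\<^bsub>-1\<^esub>\<close> and \<open>u\<^bsub>d+1\<^esub>\<close> are \<open>0\<close>.

  The extreme idempotents are products of \<open>d\<close> linear factors in \<open>A\<close> or \<open>A\<^sup>*\<close>, divided
  by a scalar. Written in this way, the word \<open>E\<^sub>0 E\<^sup>*\<^sub>d E\<^sub>d E\<^sup>*\<^sub>0\<close> raises \<open>v = u\<^sub>0\<close> to
  \<open>u\<^sub>d\<close> and then lowers it in \<open>d\<close> steps. Each step contributes one \<open>\<phi>\<^sub>i\<close>, and all the
  terms that do not come down to \<open>u\<^sub>0\<close> are killed by \<open>E\<^sub>0\<close> (\<open>word_from_bottom\<close>). In the
  same way \<open>E\<^sup>*\<^sub>d E\<^sub>0 E\<^sup>*\<^sub>0 E\<^sub>d\<close> lowers \<open>u\<^sub>d\<close> to \<open>u\<^sub>0\<close> and raises it again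
  (\<open>word_from_top\<close>).

  The other six identities follow by symmetry. In a basis of eigenvectors of \<open>A\<^sup>*\<close> the
  element \<open>A\<close> is an irreducible tridiagonal matrix, so a diagonal symmetric form makes both
  \<open>A\<close> and \<open>A\<^sup>*\<close> selfadjoint (\<open>ex_symmetrizing_form\<close>). Taking adjoints reverses each word
  and keeps its scalar, which turns the two identities into four (\<open>extreme_idempotent_words\<close>). Reversing the
  order of the \<open>E\<^sub>i\<close> gives a Leonard system whose first split sequence is the second split
  sequence of the given one, and it yields the remaining four.
\<close>

section \<open>Modules over an algebra\<close>

locale algebra_module = assoc_algebra scale + left_module act
  for scale :: "'k::field \<Rightarrow> 'a::ring_1 \<Rightarrow> 'a"
    and act :: "'a \<Rightarrow> 'v::ab_group_add \<Rightarrow> 'v"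
begin

abbreviation smul :: "'k \<Rightarrow> 'v \<Rightarrow> 'v" where
  "smul c v \<equiv> act (scale c 1) v"

lemma act_scale: "act (scale c x) v = smul c (act x v)"
proof -
  have "scale c x = scale c 1 * x"
    by (simp add: scale_mult_left)
  then show ?thesis
    by (metis act_mult)
qed

lemma act_smul: "act x (smul c v) = smul c (act x v)"
proof -
  have "x * scale c 1 = scale c 1 * x"
    by (simp add: scale_mult_left scale_mult_right)
  then show ?thesis
    by (metis act_mult)
qed

sublocale V: vector_space smul
proof
  show "smul a (v + w) = smul a v + smul a w" for a v w
    by (rule act_add_right)
  show "smul (a + b) v = smul a v + smul b v" for a b v
    by (simp add: scale_left_distrib act_add_left)
  show "smul a (smul b v) = smul (a * b) v" for a b v
    by (simp add: act_mult[symmetric] scale_mult_left)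
  show "smul 1 v = v" for v
    by (simp add: act_one)
qed

lemma smul_eq_divide:
  assumes "c \<noteq> 0" "smul c v = smul p w"
  shows "v = smul (p / c) w"
proof -
  have "smul c v = smul c (smul (p / c) w)"
    using assms by simp
  then show ?thesis
    using assms(1) V.scale_left_imp_eq by blast
qed

lemma act_zero_right [simp]: "act x 0 = 0"
  using act_add_right[of x 0 0] by simp

lemma act_zero_left [simp]: "act 0 v = 0"
  using act_add_left[of 0 0 v] by simp

lemma act_minus_right: "act x (- v) = - act x v"
  using act_add_right[of x v "- v"] by (simp add: eq_neg_iff_add_eq_0 add.commute)

lemma act_diff_right: "act x (v - w) = act x v - act x w"
  using act_add_right[of x v "- w"] by (simp add: act_minus_right)

lemma act_diff_left: "act (x - y) v = act x v - act y v"
  using act_add_left[of "x - y" y v] by simp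

lemma act_sum_right: "act x (\<Sum>i\<in>S. g i) = (\<Sum>i\<in>S. act x (g i))"
  by (induction S rule: infinite_finite_induct) (simp_all add: act_add_right)

lemma act_sum_left: "act (\<Sum>i\<in>S. g i) v = (\<Sum>i\<in>S. act (g i) v)"
  by (induction S rule: infinite_finite_induct) (simp_all add: act_add_left)

lemma act_diff_scalar: "act (x - scale c 1) v = act x v - smul c v"
  by (simp add: act_diff_left)

end

locale faithful_module = algebra_module scale act
  for scale :: "'k::field \<Rightarrow> 'a::ring_1 \<Rightarrow> 'a"
    and act :: "'a \<Rightarrow> 'v::ab_group_add \<Rightarrow> 'v" +
  assumes faithful: "(\<And>v. act x v = 0) \<Longrightarrow> x = 0"
begin

lemma eqI_act: "(\<And>v. act x v = act y v) \<Longrightarrow> x = y"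
  using faithful[of "x - y"] by (simp add: act_diff_left)

end

section \<open>Simple modules over a full matrix algebra\<close>

text \<open>
  The isomorphism with the matrix algebra, read through entries: \<open>c x i j\<close> is the entry of
  \<open>x\<close> at position \<open>(i, j)\<close>, and \<open>e p q\<close> is the element that corresponds to a matrix unit.
\<close>

locale matrix_coordinates = full_matrix_algebra scale d
  for scale :: "'k::field \<Rightarrow> 'a::ring_1 \<Rightarrow> 'a" and d +
  fixes c :: "'a \<Rightarrow> nat \<Rightarrow> nat \<Rightarrow> 'k" and e :: "nat \<Rightarrow> nat \<Rightarrow> 'a"
  assumes ext: "(\<And>i j. i \<le> d \<Longrightarrow> j \<le> d \<Longrightarrow> c x i j = c y i j) \<Longrightarrow> x = y"
    and add: "i \<le> d \<Longrightarrow> j \<le> d \<Longrightarrow> c (x + y) i j = c x i j + c y i j"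
    and mult: "i \<le> d \<Longrightarrow> j \<le> d \<Longrightarrow> c (x * y) i j = (\<Sum>k\<le>d. c x i k * c y k j)"
    and scale: "i \<le> d \<Longrightarrow> j \<le> d \<Longrightarrow> c (scale a x) i j = a * c x i j"
    and one: "i \<le> d \<Longrightarrow> j \<le> d \<Longrightarrow> c 1 i j = (if i = j then 1 else 0)"
    and unit: "i \<le> d \<Longrightarrow> j \<le> d \<Longrightarrow> c (e p q) i j = (if i = p \<and> j = q then 1 else 0)"
begin

lemma zero: "i \<le> d \<Longrightarrow> j \<le> d \<Longrightarrow> c 0 i j = 0"
  using scale[of i j 0 0] by simp

lemma sum: "i \<le> d \<Longrightarrow> j \<le> d \<Longrightarrow> c (\<Sum>p\<in>S. g p) i j = (\<Sum>p\<in>S. c (g p) i j)"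
  by (induction S rule: infinite_finite_induct) (simp_all add: zero add)

lemma one_eq_sum: "1 = (\<Sum>p\<le>d. e p p)"
proof (rule ext)
  fix i j assume ij: "i \<le> d" "j \<le> d"
  have "(\<Sum>p\<le>d. c (e p p) i j) = (\<Sum>p\<le>d. if p = i then (if i = j then 1 else 0) else 0)"
    using ij by (intro sum.cong refl) (auto simp: unit)
  then show "c 1 i j = c (\<Sum>p\<le>d. e p p) i j"
    using ij by (simp add: sum one)
qed

lemma unit_mult_unit:
  assumes "q \<le> d" "r \<le> d"
  shows "e p q * x * e r p = scale (c x q r) (e p p)"
proof (rule ext)
  fix i j assume ij: "i \<le> d" "j \<le> d"
  have "c (e p q * x * e r p) i j
      = (\<Sum>k\<le>d. \<Sum>l\<le>d. (if i = p \<and> l = q then 1 else 0) * c x l k * (if k = r \<and> j = p then 1 else 0))"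
    using ij by (simp add: mult unit sum_distrib_right)
  also have "\<dots> = (\<Sum>k\<le>d. \<Sum>l\<le>d. if l = q then
      (if k = r then (if i = p \<and> j = p then c x q r else 0) else 0) else 0)"
    by (intro sum.cong refl) auto
  also have "\<dots> = (if i = p \<and> j = p then c x q r else 0)"
    using assms by (simp add: sum.delta')
  finally show "c (e p q * x * e r p) i j = c (scale (c x q r) (e p p)) i j"
    using ij by (simp add: scale unit)
qed

lemma mult_unit_column: "x * e 0 0 = (\<Sum>i\<le>d. scale (c x i 0) (e i 0))"
proof (rule ext)
  fix i j assume ij: "i \<le> d" "j \<le> d"
  have "c (x * e 0 0) i j = (\<Sum>k\<le>d. if k = 0 then (if j = 0 then c x i 0 else 0) else 0)"
    using ij unfolding mult[OF ij] by (intro sum.cong refl) (auto simp: unit)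
  moreover have "c (\<Sum>k\<le>d. scale (c x k 0) (e k 0)) i j
      = (\<Sum>k\<le>d. if k = i then (if j = 0 then c x i 0 else 0) else 0)"
    using ij unfolding sum[OF ij] by (intro sum.cong refl) (auto simp: unit scale)
  ultimately show "c (x * e 0 0) i j = c (\<Sum>i\<le>d. scale (c x i 0) (e i 0)) i j"
    using ij by simp
qed

lemma unit_idem: "e 0 0 * e 0 0 = e 0 0"
proof (rule ext)
  fix i j assume ij: "i \<le> d" "j \<le> d"
  have "c (e 0 0 * e 0 0) i j = (\<Sum>k\<le>d. if k = 0 then (if i = 0 \<and> j = 0 then 1 else 0) else 0)"
    using ij unfolding mult[OF ij] by (intro sum.cong refl) (auto simp: unit)
  then show "c (e 0 0 * e 0 0) i j = c (e 0 0) i j"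
    using ij by (simp add: unit)
qed

end

lemma (in full_matrix_algebra) ex_matrix_coordinates:
  "\<exists>c e. matrix_coordinates scale d c e"
proof -
  obtain f where f: "bij_betw f UNIV (carrier_mat (d + 1) (d + 1))"
    and fadd: "\<And>x y. f (x + y) = f x + f y"
    and fmult: "\<And>x y. f (x * y) = f x * f y"
    and fone: "f 1 = 1\<^sub>m (d + 1)"
    and fscale: "\<And>a x. f (scale a x) = a \<cdot>\<^sub>m f x"
    using iso_mat by auto
  have car [simp]: "f x \<in> carrier_mat (d + 1) (d + 1)" for x
    using f by (auto simp: bij_betw_def)
  have dims [simp]: "dim_row (f x) = d + 1" "dim_col (f x) = d + 1" for x
    using car[of x] by auto
  have inj: "f x = f y \<Longrightarrow> x = y" for x y
    using f by (auto simp: bij_betw_def inj_on_def)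
  have "\<exists>x. f x = mat (d + 1) (d + 1) (\<lambda>(i, j). if i = p \<and> j = q then 1 else 0)" for p q
  proof -
    have "mat (d + 1) (d + 1) (\<lambda>(i, j). if i = p \<and> j = q then 1 else 0) \<in> range f"
      using f by (simp add: bij_betw_def)
    then show ?thesis by (auto simp: image_iff)
  qed
  then obtain e where
    e: "\<And>p q. f (e p q) = mat (d + 1) (d + 1) (\<lambda>(i, j). if i = p \<and> j = q then 1 else 0)"
    by metis
  have "matrix_coordinates scale d (\<lambda>x i j. f x $$ (i, j)) e"
  proof
    fix x y assume eq: "\<And>i j. i \<le> d \<Longrightarrow> j \<le> d \<Longrightarrow> f x $$ (i, j) = f y $$ (i, j)"
    show "x = y"
      by (rule inj, rule eq_matI) (simp_all add: eq)
  next
    fix x y i j assume "i \<le> d" "j \<le> d"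
    then have "f (x * y) $$ (i, j) = (\<Sum>k<Suc d. f x $$ (i, k) * f y $$ (k, j))"
      by (simp add: fmult scalar_prod_def lessThan_atLeast0)
    then show "f (x * y) $$ (i, j) = (\<Sum>k\<le>d. f x $$ (i, k) * f y $$ (k, j))"
      by (simp only: lessThan_Suc_atMost)
  qed (simp_all add: fadd fone fscale e)
  then show ?thesis by blast
qed

locale simple_matrix_module = full_matrix_algebra scale d + simple_left_module act
  for scale :: "'k::field \<Rightarrow> 'a::ring_1 \<Rightarrow> 'a" and d
    and act :: "'a \<Rightarrow> 'v::ab_group_add \<Rightarrow> 'v"
begin

sublocale algebra_module scale act ..

text \<open>
  The annihilator of \<open>V\<close> is a two-sided ideal. If it contained an element with a nonzero
  entry, cutting that entry out with matrix units would put all diagonal matrix units, and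
  hence \<open>1\<close>, into the annihilator.
\<close>

sublocale faithful_module scale act
proof
  fix x assume ann: "\<And>v. act x v = 0"
  obtain c e where "matrix_coordinates scale d c e"
    using ex_matrix_coordinates by blast
  then interpret M: matrix_coordinates scale d c e .
  show "x = 0"
  proof (rule ccontr)
    assume "x \<noteq> 0"
    then obtain q r where qr: "q \<le> d" "r \<le> d" "c x q r \<noteq> 0"
      using M.ext[of x 0] M.zero by metis
    have "act (e p p) v = 0" for p v
    proof -
      have "smul (c x q r) (act (e p p) v) = act (e p q * x * e r p) v"
        unfolding M.unit_mult_unit[OF qr(1,2)] by (rule act_scale[symmetric])
      also have "\<dots> = 0"
        by (simp add: act_mult ann)
      finally show ?thesis using qr(3) by simp
    qed
    then have "act 1 v = 0" for v
      unfolding M.one_eq_sum act_sum_left by simp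
    then have "v = 0" for v :: 'v
      unfolding act_one .
    then show False
      using nonzero by simp
  qed
qed

text \<open>
  For a nonzero vector \<open>w\<close> in the image of the matrix unit \<open>e\<^bsub>00\<^esub>\<close>, simplicity makes every
  vector a multiple \<open>x w = x e\<^bsub>00\<^esub> w\<close>, and only the first column of \<open>x\<close> matters. This is
  the half of \<open>dim V = d + 1\<close> that forces the eigenspaces of a multiplicity-free element to
  be lines.
\<close>

lemma spanning_set:
  obtains T where "finite T" "card T \<le> d + 1" "V.span T = UNIV"
proof -
  obtain c e where "matrix_coordinates scale d c e"
    using ex_matrix_coordinates by blast
  then interpret M: matrix_coordinates scale d c e .
  have "e 0 0 \<noteq> 0"
    using M.unit[of 0 0 0 0] M.zero[of 0 0] by auto
  then obtain v where v: "act (e 0 0) v \<noteq> 0"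
    using faithful by blast
  define w where "w = act (e 0 0) v"
  define T where "T = (\<lambda>i. act (e i 0) w) ` {..d}"
  have in_span: "act x w \<in> V.span T" for x
  proof -
    have "act x w = act (x * e 0 0) w"
      unfolding w_def by (metis act_mult M.unit_idem)
    also have "\<dots> = (\<Sum>i\<le>d. smul (c x i 0) (act (e i 0) w))"
      by (simp add: M.mult_unit_column act_sum_left act_scale[of _ "e _ _"])
    also have "\<dots> \<in> V.span T"
      by (intro V.span_sum V.span_scale V.span_base) (auto simp: T_def)
    finally show ?thesis .
  qed
  have "submodule act (range (\<lambda>x. act x w))"
    unfolding submodule_def
  proof (intro conjI ballI allI)
    show "0 \<in> range (\<lambda>x. act x w)"
      by (rule range_eqI[of _ _ 0]) simp
  qed (auto simp: act_add_left[symmetric] act_mult[symmetric])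
  moreover have "range (\<lambda>x. act x w) \<noteq> {0}"
  proof
    assume "range (\<lambda>x. act x w) = {0}"
    then have "act 1 w = 0" by blast
    then show False using v by (simp add: act_one w_def)
  qed
  ultimately have "range (\<lambda>x. act x w) = UNIV"
    using simple[of "range (\<lambda>x. act x w)"] by simp
  moreover have "range (\<lambda>x. act x w) \<subseteq> V.span T"
    using in_span by (rule image_subsetI)
  ultimately have "V.span T = UNIV"
    by (simp only: top.extremum_unique)
  moreover have "finite T" "card T \<le> d + 1"
    using card_image_le[of "{..d}" "\<lambda>i. act (e i 0) w"] by (simp_all add: T_def)
  ultimately show thesis by (intro that)
qed

end

section \<open>Multiplicity-free elements\<close>

text \<open>
  What the proof needs to know about a multiplicity-free \<open>X\<close>, expressed through the action
  on \<open>V\<close>: the \<open>E i\<close> are the projections onto the eigenspaces of \<open>X\<close>, which are lines.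
\<close>

locale spectral_family = faithful_module scale act
  for scale :: "'k::field \<Rightarrow> 'a::ring_1 \<Rightarrow> 'a"
    and act :: "'a \<Rightarrow> 'v::ab_group_add \<Rightarrow> 'v" +
  fixes d :: nat and X :: 'a and E :: "nat \<Rightarrow> 'a" and \<theta> :: "nat \<Rightarrow> 'k"
  assumes inj: "inj_on \<theta> {..d}"
    and sum_one: "(\<Sum>i\<le>d. act (E i) v) = v"
    and orth: "\<lbrakk>i \<le> d; j \<le> d\<rbrakk> \<Longrightarrow> act (E i) (act (E j) v) = (if i = j then act (E i) v else 0)"
    and eig_left: "i \<le> d \<Longrightarrow> act X (act (E i) v) = smul (\<theta> i) (act (E i) v)"
    and eig_right: "i \<le> d \<Longrightarrow> act (E i) (act X v) = smul (\<theta> i) (act (E i) v)"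
    and one_dim: "\<lbrakk>i \<le> d; act (E i) v \<noteq> 0\<rbrakk> \<Longrightarrow> \<exists>c. act (E i) w = smul c (act (E i) v)"
    and nonzero: "i \<le> d \<Longrightarrow> \<exists>v. act (E i) v \<noteq> 0"

lemma (in algebra_module) act_primitive_idempotent:
  assumes "act X y = smul (\<theta> j) y"
  shows "act (primitive_idempotent scale d X \<theta> i) y
    = smul (\<Prod>k\<in>{..d} - {i}. (\<theta> j - \<theta> k) / (\<theta> i - \<theta> k)) y"
proof -
  have "act (prod_list (map (\<lambda>k. scale (inverse (\<theta> i - \<theta> k)) (X - scale (\<theta> k) 1)) ks)) y
      = smul (prod_list (map (\<lambda>k. (\<theta> j - \<theta> k) / (\<theta> i - \<theta> k)) ks)) y" for ks
  proof (induction ks)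
    case (Cons k ks)
    have "act (X - scale (\<theta> k) 1) y = smul (\<theta> j - \<theta> k) y"
      unfolding act_diff_scalar assms by (rule V.scale_left_diff_distrib[symmetric])
    then have "act (scale (inverse (\<theta> i - \<theta> k)) (X - scale (\<theta> k) 1)) (smul b y)
        = smul ((\<theta> j - \<theta> k) / (\<theta> i - \<theta> k) * b) y" for b
      unfolding act_scale[of _ "X - scale (\<theta> k) 1"] act_smul[of "X - scale (\<theta> k) 1"]
      by (simp add: divide_inverse mult.commute mult.left_commute)
    then show ?case
      using Cons by (simp add: act_mult)
  qed (simp add: act_one)
  moreover have "prod_list (map f (filter (\<lambda>k. k \<noteq> i) [0..<d + 1])) = prod f ({..d} - {i})" for f :: "nat \<Rightarrow> 'k"
  proof -
    have "prod_list (map f (filter (\<lambda>k. k \<noteq> i) [0..<d + 1]))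
        = prod f (set (filter (\<lambda>k. k \<noteq> i) [0..<d + 1]))"
      by (rule prod.distinct_set_conv_list[symmetric]) (rule distinct_filter[OF distinct_upt])
    also have "set (filter (\<lambda>k. k \<noteq> i) [0..<d + 1]) = {..d} - {i}"
      by auto
    finally show ?thesis .
  qed
  ultimately show ?thesis
    unfolding primitive_idempotent_def by (simp only:)
qed

text \<open>
  Eigenvectors \<open>y\<^sub>0, \<dots>, y\<^sub>d\<close> for the distinct eigenvalues satisfy
  \<open>E\<^sub>i y\<^sub>j = \<delta>\<^bsub>ij\<^esub> y\<^sub>j\<close>, so they are independent; being \<open>d + 1\<close> in number, they form a
  basis, on which everything can be read off.
\<close>

lemma (in simple_matrix_module) spectral_family:
  assumes "idempotent_ordering scale act d X E \<theta>"
  shows "spectral_family scale act d X E \<theta>"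
proof -
  have bij: "bij_betw \<theta> {0..d} (eigenvalues scale act X)"
    and E: "\<And>i. i \<le> d \<Longrightarrow> E i = primitive_idempotent scale d X \<theta> i"
    using assms by (auto simp: idempotent_ordering_def)
  have inj: "inj_on \<theta> {..d}"
    using bij by (auto simp: bij_betw_def atMost_atLeast0)
  have "\<exists>y. y \<noteq> 0 \<and> act X y = smul (\<theta> i) y" if "i \<le> d" for i
    using bij_betwE[OF bij] that by (auto simp: eigenvalues_def eigenvalue_on_def)
  then obtain y where y0: "\<And>i. i \<le> d \<Longrightarrow> y i \<noteq> 0"
    and Xy: "\<And>i. i \<le> d \<Longrightarrow> act X (y i) = smul (\<theta> i) (y i)"
    by metis
  have Ey: "act (E i) (y j) = (if i = j then y j else 0)" if "i \<le> d" "j \<le> d" for i j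
  proof -
    have coeff: "(\<Prod>k\<in>{..d} - {i}. (\<theta> j - \<theta> k) / (\<theta> i - \<theta> k)) = (if i = j then 1 else 0)"
    proof (cases "i = j")
      case True
      have "\<theta> j \<noteq> \<theta> k" if "k \<in> {..d} - {j}" for k
        using that \<open>j \<le> d\<close> inj_onD[OF inj, of j k] by auto
      then have "(\<Prod>k\<in>{..d} - {j}. (\<theta> j - \<theta> k) / (\<theta> j - \<theta> k)) = 1"
        by (intro prod.neutral) simp
      then show ?thesis
        using True by simp
    next
      case False
      then have "j \<in> {..d} - {i}"
        using that by simp
      then have "(\<Prod>k\<in>{..d} - {i}. (\<theta> j - \<theta> k) / (\<theta> i - \<theta> k)) = 0"
        by (intro prod_zero) (auto intro: bexI[of _ j])
      then show ?thesis using False by simp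
    qed
    show ?thesis
      unfolding E[OF that(1)] act_primitive_idempotent[where \<theta> = \<theta> and j = j and y = "y j", OF Xy[OF that(2)]] coeff
      by (cases "i = j") (simp_all add: act_one)
  qed
  have yinj: "inj_on y {..d}"
  proof (rule inj_onI)
    fix i j assume "i \<in> {..d}" "j \<in> {..d}" "y i = y j"
    then show "i = j"
      using Ey[of i j] Ey[of i i] y0[of i] by (auto split: if_splits)
  qed
  have indep: "V.independent (y ` {..d})"
  proof (rule V.independent_if_scalars_zero)
    fix f x assume sum0: "(\<Sum>x\<in>y ` {..d}. smul (f x) x) = 0" and "x \<in> y ` {..d}"
    then obtain i where i: "i \<le> d" "x = y i" by auto
    have sum0': "(\<Sum>j\<le>d. smul (f (y j)) (y j)) = 0"
      using sum0 by (simp add: sum.reindex[OF yinj])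
    have "0 = (\<Sum>j\<le>d. act (E i) (smul (f (y j)) (y j)))"
      unfolding act_sum_right[symmetric] sum0' by simp
    also have "\<dots> = (\<Sum>j\<le>d. if j = i then smul (f (y i)) (y i) else 0)"
      using i by (intro sum.cong refl) (auto simp: act_smul[of "E _"] Ey)
    also have "\<dots> = smul (f x) (y i)"
      using i by simp
    finally show "f x = 0" using y0 i by simp
  qed simp
  have span: "V.span (y ` {..d}) = UNIV"
  proof (rule ccontr)
    assume "V.span (y ` {..d}) \<noteq> UNIV"
    then obtain v where v: "v \<notin> V.span (y ` {..d})" by auto
    obtain T where T: "finite T" "card T \<le> d + 1" "V.span T = UNIV"
      by (rule spanning_set)
    have "V.independent (insert v (y ` {..d}))"
      using indep v by (simp add: V.independent_insertI)
    then have "card (insert v (y ` {..d})) \<le> card T"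
      using V.independent_span_bound[OF T(1)] T(3) by auto
    moreover have "v \<notin> y ` {..d}" using v V.span_base[of v "y ` {..d}"] by fast
    ultimately show False
      using T(2) by (simp add: card_image[OF yinj])
  qed
  have expand: "\<exists>c. v = (\<Sum>j\<le>d. smul (c j) (y j))" for v
  proof -
    have "v \<in> V.span (y ` {..d})" using span by simp
    then obtain u where "v = (\<Sum>x\<in>y ` {..d}. smul (u x) x)"
      unfolding V.span_finite[OF finite_imageI[OF finite_atMost]] by blast
    then show ?thesis
      by (intro exI[of _ "u \<circ> y"]) (simp add: sum.reindex[OF yinj])
  qed
  have Esum: "act (E i) (\<Sum>j\<le>d. smul (c j) (y j)) = smul (c i) (y i)" if "i \<le> d" for i c
  proof -
    have "act (E i) (\<Sum>j\<le>d. smul (c j) (y j)) = (\<Sum>j\<le>d. if j = i then smul (c i) (y i) else 0)"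
      using that unfolding act_sum_right by (intro sum.cong refl) (auto simp: act_smul[of "E _"] Ey)
    then show ?thesis using that by simp
  qed
  have Xsum: "act X (\<Sum>j\<le>d. smul (c j) (y j)) = (\<Sum>j\<le>d. smul (\<theta> j * c j) (y j))" for c
    unfolding act_sum_right by (intro sum.cong refl) (simp add: act_smul[of X] Xy mult.commute)
  show ?thesis
  proof
    fix v
    obtain c where c: "v = (\<Sum>j\<le>d. smul (c j) (y j))" using expand by blast
    show "(\<Sum>i\<le>d. act (E i) v) = v"
      unfolding c by (rule sum.cong) (simp_all add: Esum)
    fix i assume i: "i \<le> d"
    show "act (E i) (act X v) = smul (\<theta> i) (act (E i) v)"
      using i unfolding c Xsum by (simp add: Esum)
    show "act X (act (E i) v) = smul (\<theta> i) (act (E i) v)"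
      using i unfolding c by (simp add: Esum act_smul[of X] Xy mult.commute)
    show "\<exists>v. act (E i) v \<noteq> 0"
      using Ey y0 i by (intro exI[of _ "y i"]) simp
    {
      fix j assume "j \<le> d"
      then show "act (E i) (act (E j) v) = (if i = j then act (E i) v else 0)"
        using i unfolding c by (simp add: Esum act_smul[of "E _"] Ey)
    next
      fix w assume nz: "act (E i) v \<noteq> 0"
      obtain b where b: "w = (\<Sum>j\<le>d. smul (b j) (y j))" using expand by blast
      have "c i \<noteq> 0" using nz i unfolding c by (auto simp: Esum)
      then show "\<exists>a. act (E i) w = smul a (act (E i) v)"
        using i unfolding b c by (intro exI[of _ "b i / c i"]) (simp add: Esum)
    }
  qed (rule inj)
qed

lemma (in spectral_family) proj_shift:
  assumes "i \<le> d"
  shows "act (E i) (act (X - scale c 1) v) = smul (\<theta> i - c) (act (E i) v)"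
  unfolding act_diff_scalar act_diff_right eig_right[OF assms] act_smul[of "E i"]
  by (rule V.scale_left_diff_distrib[symmetric])

lemma (in spectral_family) eqI_proj:
  assumes "\<And>i. i \<le> d \<Longrightarrow> act (E i) v = act (E i) w"
  shows "v = w"
proof -
  have "(\<Sum>i\<le>d. act (E i) v) = (\<Sum>i\<le>d. act (E i) w)"
    using assms by (intro sum.cong) simp_all
  then show ?thesis unfolding sum_one .
qed

text \<open>
  \<open>ladder X c v k\<close> is \<open>(X - c\<^bsub>k-1\<^esub>) \<cdots> (X - c\<^sub>0) v\<close>. For \<open>c = \<theta>\<close> and for \<open>c\<close> the reverse
  of \<open>\<theta>\<close> this is the value at \<open>v\<close> of \<open>\<tau>\<^sub>k(X)\<close> and of \<open>\<eta>\<^sub>k(X)\<close>; for \<open>k = d\<close> the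
  product annihilates all eigenspaces but one, so it is a multiple of a primitive idempotent.
\<close>

primrec (in algebra_module) ladder :: "'a \<Rightarrow> (nat \<Rightarrow> 'k) \<Rightarrow> 'v \<Rightarrow> nat \<Rightarrow> 'v" where
  "ladder X c v 0 = v"
| "ladder X c v (Suc k) = act (X - scale (c k) 1) (ladder X c v k)"

lemma (in spectral_family) proj_ladder:
  assumes "i \<le> d"
  shows "act (E i) (ladder X c v k) = smul (\<Prod>j<k. \<theta> i - c j) (act (E i) v)"
  by (induction k) (simp_all add: proj_shift[OF assms] act_one mult.commute)

lemma (in spectral_family) ladder_full:
  assumes m: "m \<le> d" and c: "\<And>j. \<lbrakk>j \<le> d; j \<noteq> m\<rbrakk> \<Longrightarrow> \<exists>k<d. c k = \<theta> j"
  shows "ladder X c v d = smul (\<Prod>j<d. \<theta> m - c j) (act (E m) v)"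
proof (rule eqI_proj)
  fix i assume i: "i \<le> d"
  have "(\<Prod>j<d. \<theta> i - c j) = 0" if "i \<noteq> m"
  proof -
    obtain k where "k < d" "c k = \<theta> i"
      using c[OF i \<open>i \<noteq> m\<close>] by blast
    then show ?thesis by (intro prod_zero bexI[of _ k]) auto
  qed
  then show "act (E i) (ladder X c v d) = act (E i) (smul (\<Prod>j<d. \<theta> m - c j) (act (E m) v))"
    unfolding proj_ladder[OF i] act_smul[of "E i"] orth[OF i m] by auto
qed

section \<open>Reversing words by a symmetric bilinear form\<close>

locale bilinear_form = algebra_module scale act
  for scale :: "'k::field \<Rightarrow> 'a::ring_1 \<Rightarrow> 'a"
    and act :: "'a \<Rightarrow> 'v::ab_group_add \<Rightarrow> 'v" +
  fixes B :: "'v \<Rightarrow> 'v \<Rightarrow> 'k"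
  assumes add_left: "B (v + v') w = B v w + B v' w"
    and add_right: "B v (w + w') = B v w + B v w'"
    and smul_left: "B (smul c v) w = c * B v w"
    and smul_right: "B v (smul c w) = c * B v w"
begin

definition selfadjoint :: "'a \<Rightarrow> bool" where
  "selfadjoint x \<longleftrightarrow> (\<forall>v w. B (act x v) w = B v (act x w))"

lemma sum_left: "B (\<Sum>i\<in>S. g i) w = (\<Sum>i\<in>S. B (g i) w)"
  using smul_left[of 0 0 w]
  by (induction S rule: infinite_finite_induct) (simp_all add: add_left)

lemma sum_right: "B v (\<Sum>i\<in>S. g i) = (\<Sum>i\<in>S. B v (g i))"
  using smul_right[of v 0 0]
  by (induction S rule: infinite_finite_induct) (simp_all add: add_right)

text \<open>The eigenspaces of a selfadjoint element are orthogonal to each other.\<close>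

lemma selfadjoint_idempotent:
  assumes "spectral_family scale act d X E \<theta>" and X: "selfadjoint X" and i: "i \<le> d"
  shows "selfadjoint (E i)"
proof -
  interpret X: spectral_family scale act d X E \<theta> by fact
  have ortho: "B (act (E j) v) (act (E k) w) = 0" if jk: "j \<le> d" "k \<le> d" "j \<noteq> k" for j k v w
  proof -
    have "\<theta> j * B (act (E j) v) (act (E k) w) = B (act X (act (E j) v)) (act (E k) w)"
      unfolding X.eig_left[OF jk(1)] smul_left ..
    also have "\<dots> = \<theta> k * B (act (E j) v) (act (E k) w)"
      unfolding X[unfolded selfadjoint_def, rule_format] X.eig_left[OF jk(2)] smul_right ..
    finally show ?thesis
      using inj_onD[OF X.inj, of j k] jk by auto
  qed
  show ?thesis
    unfolding selfadjoint_def
  proof (intro allI)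
    fix v w
    have "B (act (E i) v) w = (\<Sum>j\<le>d. B (act (E i) v) (act (E j) w))"
      unfolding sum_right[symmetric] X.sum_one ..
    also have "\<dots> = (\<Sum>j\<le>d. if j = i then B (act (E i) v) (act (E i) w) else 0)"
      using i by (intro sum.cong) (auto simp: ortho)
    also have "\<dots> = (\<Sum>j\<le>d. B (act (E j) v) (act (E i) w))"
      using i by (intro sum.cong) (auto simp: ortho)
    also have "\<dots> = B v (act (E i) w)"
      unfolding sum_left[symmetric] X.sum_one ..
    finally show "B (act (E i) v) w = B v (act (E i) w)" .
  qed
qed

end

locale nondegenerate_form = bilinear_form scale act B + faithful_module scale act
  for scale :: "'k::field \<Rightarrow> 'a::ring_1 \<Rightarrow> 'a"
    and act :: "'a \<Rightarrow> 'v::ab_group_add \<Rightarrow> 'v" and B +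
  assumes nondegenerate: "(\<And>w. B v w = 0) \<Longrightarrow> v = 0"
begin

lemma reverse_word:
  assumes adj: "selfadjoint P" "selfadjoint Q" "selfadjoint R" "selfadjoint S"
    and eq: "P * Q * R * S = scale c (P * S)"
  shows "S * R * Q * P = scale c (S * P)"
proof (rule eqI_act)
  fix v
  note adj' = adj[unfolded selfadjoint_def, rule_format]
  have "B (act (S * R * Q * P) v - act (scale c (S * P)) v) w = 0" for w
  proof -
    have "B (act (S * R * Q * P) v) w = B v (act (P * Q * R * S) w)"
      by (simp add: act_mult adj')
    also have "\<dots> = B v (smul c (act (P * S) w))"
      unfolding eq by (simp only: act_scale[of c "P * S"])
    also have "\<dots> = B (smul c (act (S * P) v)) w"
      by (simp add: act_mult adj' smul_left smul_right)
    also have "\<dots> = B (act (scale c (S * P)) v) w"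
      by (simp only: act_scale[of c "S * P"])
    finally show ?thesis
      using add_left[of "act (S * R * Q * P) v - act (scale c (S * P)) v" "act (scale c (S * P)) v" w]
      by simp
  qed
  then have "act (S * R * Q * P) v - act (scale c (S * P)) v = 0"
    by (rule nondegenerate)
  then show "act (S * R * Q * P) v = act (scale c (S * P)) v" by simp
qed

end

section \<open>Opposite flags and split vectors\<close>

text \<open>
  The tridiagonal relations of a Leonard system in terms of the action. Nonvanishing is stated
  for vectors: as the eigenspaces are lines, a nonzero \<open>E\<^sup>*\<^sub>i A E\<^sup>*\<^sub>j\<close> is injective on
  \<open>E\<^sup>*\<^sub>j V\<close>.
\<close>

locale leonard =
  A: spectral_family scale act d A E \<theta> + S: spectral_family scale act d As Es \<theta>s
  for scale :: "'k::field \<Rightarrow> 'a::ring_1 \<Rightarrow> 'a"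
    and act :: "'a \<Rightarrow> 'v::ab_group_add \<Rightarrow> 'v"
    and d A E \<theta> As Es \<theta>s +
  assumes As_zero: "\<lbrakk>i \<le> d; j \<le> d; Suc i < j \<or> Suc j < i\<rbrakk> \<Longrightarrow> act (E i) (act As (act (E j) v)) = 0"
    and A_zero: "\<lbrakk>i \<le> d; j \<le> d; Suc i < j \<or> Suc j < i\<rbrakk> \<Longrightarrow> act (Es i) (act A (act (Es j) v)) = 0"
    and A_nonzero: "\<lbrakk>i \<le> d; j \<le> d; i = Suc j \<or> j = Suc i; act (Es j) v \<noteq> 0\<rbrakk>
      \<Longrightarrow> act (Es i) (act A (act (Es j) v)) \<noteq> 0"
begin

abbreviation smul :: "'k \<Rightarrow> 'v \<Rightarrow> 'v" where
  "smul \<equiv> A.smul"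

text \<open>
  The two flags, given by the components that vanish: \<open>below r v\<close> says that \<open>v\<close> lies in
  \<open>E\<^sup>*\<^sub>0 V + \<dots> + E\<^sup>*\<^bsub>r-1\<^esub> V\<close>, and \<open>above i v\<close> that it lies in \<open>E\<^sub>i V + \<dots> + E\<^sub>d V\<close>.
  Excluding \<open>r\<close> makes \<open>below 0\<close> the zero space.
\<close>

definition below :: "nat \<Rightarrow> 'v \<Rightarrow> bool" where
  "below r v \<longleftrightarrow> (\<forall>j\<le>d. r \<le> j \<longrightarrow> act (Es j) v = 0)"

definition above :: "nat \<Rightarrow> 'v \<Rightarrow> bool" where
  "above i v \<longleftrightarrow> (\<forall>j\<le>d. j < i \<longrightarrow> act (E j) v = 0)"

lemma below_add: "below r v \<Longrightarrow> below r w \<Longrightarrow> below r (v + w)"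
  by (simp add: below_def A.act_add_right)

lemma below_diff: "below r v \<Longrightarrow> below r w \<Longrightarrow> below r (v - w)"
  by (simp add: below_def A.act_diff_right)

lemma below_smul: "below r v \<Longrightarrow> below r (smul c v)"
  by (simp add: below_def A.act_smul[of "Es _"])

lemma above_add: "above r v \<Longrightarrow> above r w \<Longrightarrow> above r (v + w)"
  by (simp add: above_def A.act_add_right)

lemma above_diff: "above r v \<Longrightarrow> above r w \<Longrightarrow> above r (v - w)"
  by (simp add: above_def A.act_diff_right)

lemma above_smul: "above r v \<Longrightarrow> above r (smul c v)"
  by (simp add: above_def A.act_smul[of "E _"])

lemma below_Suc: "below (Suc r) v \<Longrightarrow> act (Es r) v = 0 \<Longrightarrow> below r v"
  unfolding below_def by (metis le_antisym not_less_eq_eq)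

lemma proj_A: "act (Es j) (act A v) = (\<Sum>k\<le>d. act (Es j) (act A (act (Es k) v)))"
  unfolding A.act_sum_right[symmetric] S.sum_one ..

lemma proj_As: "act (E j) (act As v) = (\<Sum>k\<le>d. act (E j) (act As (act (E k) v)))"
  unfolding A.act_sum_right[symmetric] A.sum_one ..

lemma below_shift:
  assumes "below r v"
  shows "below (Suc r) (act (A - scale c 1) v)"
proof -
  have "act (Es j) (act A v) = 0" if j: "j \<le> d" "Suc r \<le> j" for j
  proof -
    have "act (Es j) (act A (act (Es k) v)) = 0" if "k \<le> d" for k
      using assms A_zero[of j k v] j that by (cases "r \<le> k") (auto simp: below_def)
    then show ?thesis unfolding proj_A[of j v] by (intro sum.neutral) simp
  qed
  then show ?thesis
    using assms unfolding below_def
    by (auto simp: A.act_diff_scalar A.act_diff_right A.act_smul[of "Es _"])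
qed

lemma above_shift_star:
  assumes "above (Suc i) v"
  shows "above i (act (As - scale c 1) v)"
proof -
  have "act (E j) (act As v) = 0" if j: "j \<le> d" "j < i" for j
  proof -
    have "act (E j) (act As (act (E k) v)) = 0" if "k \<le> d" for k
      using assms As_zero[of j k v] j that by (cases "k \<le> i") (auto simp: above_def)
    then show ?thesis unfolding proj_As[of j v] by (intro sum.neutral) simp
  qed
  then show ?thesis
    using assms unfolding above_def
    by (auto simp: A.act_diff_scalar A.act_diff_right A.act_smul[of "E _"])
qed

lemma below_shift_star: "below (Suc r) v \<Longrightarrow> below r (act (As - scale (\<theta>s r) 1) v)"
  unfolding below_def
proof (intro allI impI)
  fix j assume v: "\<forall>j\<le>d. Suc r \<le> j \<longrightarrow> act (Es j) v = 0" and j: "j \<le> d" "r \<le> j"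
  show "act (Es j) (act (As - scale (\<theta>s r) 1) v) = 0"
    using v j unfolding S.proj_shift[OF j(1)] by (cases "j = r") auto
qed

lemma above_shift: "above i v \<Longrightarrow> above (Suc i) (act (A - scale (\<theta> i) 1) v)"
  unfolding above_def
proof (intro allI impI)
  fix j assume v: "\<forall>j\<le>d. j < i \<longrightarrow> act (E j) v = 0" and j: "j \<le> d" "j < Suc i"
  show "act (E j) (act (A - scale (\<theta> i) 1) v) = 0"
    using v j unfolding A.proj_shift[OF j(1)] by (cases "j = i") auto
qed

lemma top_component:
  assumes "below (Suc r) v" "Suc r \<le> d"
  shows "act (Es (Suc r)) (act (A - scale c 1) v) = act (Es (Suc r)) (act A (act (Es r) v))"
proof -
  have "act (Es (Suc r)) (act A (act (Es k) v))
      = (if k = r then act (Es (Suc r)) (act A (act (Es r) v)) else 0)" if "k \<le> d" for k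
    using assms A_zero[of "Suc r" k v] that by (cases "Suc r \<le> k") (auto simp: below_def)
  then have "act (Es (Suc r)) (act A v)
      = (\<Sum>k\<le>d. if k = r then act (Es (Suc r)) (act A (act (Es r) v)) else 0)"
    unfolding proj_A[of "Suc r" v] by (intro sum.cong) auto
  also have "\<dots> = act (Es (Suc r)) (act A (act (Es r) v))"
    using assms(2) by simp
  finally show ?thesis
    using assms by (simp add: A.act_diff_scalar A.act_diff_right A.act_smul[of "Es _"] below_def)
qed

text \<open>
  The element \<open>A - \<theta>\<^sub>i\<close> moves a vector in the intersection one step up in both flags, which
  are again in the position assumed here. So induction down from \<open>i = d + 1\<close>, where \<open>above\<close>
  leaves only \<open>0\<close>, shows that the image of \<open>v\<close> vanishes. But \<open>A\<close> maps the highest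
  \<open>E\<^sup>*\<close>-component of \<open>v\<close> injectively to the next line, so this component is zero and \<open>r\<close>
  can be lowered.
\<close>

lemma flags_opposite:
  assumes "r \<le> i" "below r v" "above i v"
  shows "v = 0"
  using assms
proof (induction "Suc d - i" arbitrary: i r v)
  case 0
  then show ?case by - (rule A.eqI_proj, simp add: above_def)
next
  case (Suc n)
  have i: "i \<le> d" using Suc.hyps(2) by simp
  have "\<lbrakk>r \<le> i; below r v\<rbrakk> \<Longrightarrow> v = 0" for r
  proof (induction r)
    case 0
    then show ?case by - (rule S.eqI_proj, simp add: below_def)
  next
    case r: (Suc r)
    have "act (A - scale (\<theta> i) 1) v = 0"
    proof (rule Suc.hyps(1))
      show "n = Suc d - Suc i" using Suc.hyps(2) by simp
      show "Suc (Suc r) \<le> Suc i" using r.prems by simp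
    qed (intro below_shift above_shift r.prems Suc.prems)+
    then have "act (Es (Suc r)) (act A (act (Es r) v)) = 0"
      using top_component[of r v "\<theta> i"] r.prems i by simp
    then have "act (Es r) v = 0"
      using A_nonzero[of "Suc r" r v] r.prems i by auto
    then have "below r v"
      by (rule below_Suc[OF r.prems(2)])
    then show ?case using r.prems by (intro r.IH) simp_all
  qed
  then show ?case using Suc.prems(1,2) .
qed

definition split_vector :: "'v \<Rightarrow> nat \<Rightarrow> 'v" where
  "split_vector v = A.ladder A \<theta> v"

lemma split_vector_0 [simp]: "split_vector v 0 = v"
  by (simp add: split_vector_def)

lemma split_vector_Suc: "split_vector v (Suc k) = act (A - scale (\<theta> k) 1) (split_vector v k)"
  by (simp add: split_vector_def)

lemma split_vector_above: "above k (split_vector v k)"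
  by (induction k) (simp_all add: above_def[of 0] split_vector_Suc above_shift)

lemma split_vector_below:
  assumes "act (Es 0) v = v"
  shows "below (Suc k) (split_vector v k)"
proof (induction k)
  case 0
  have "act (Es j) v = 0" if "j \<le> d" "Suc 0 \<le> j" for j
    using S.orth[OF that(1), of 0 v] that assms by simp
  then show ?case by (simp add: below_def)
qed (simp add: split_vector_Suc below_shift)

lemma split_vector_top:
  assumes "act (Es 0) v = v" "v \<noteq> 0" "k \<le> d"
  shows "act (Es k) (split_vector v k) \<noteq> 0"
  using assms(3)
proof (induction k)
  case 0
  then show ?case using assms by simp
next
  case (Suc k)
  then show ?case
    unfolding split_vector_Suc top_component[OF split_vector_below[OF assms(1)] Suc.prems]
    by (intro A_nonzero) simp_all
qed

text \<open>
  Subtracting the multiple of \<open>u\<^sub>i\<close> with the same \<open>E\<^sup>*\<^sub>i\<close>-component leaves a vector in the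
  intersection of two opposite flags.
\<close>

lemma split_space_spanned:
  assumes v: "act (Es 0) v = v" "v \<noteq> 0" and i: "i \<le> d"
    and w: "below (Suc i) w" "above i w"
  shows "\<exists>c. w = smul c (split_vector v i)"
proof -
  obtain c where c: "act (Es i) w = smul c (act (Es i) (split_vector v i))"
    using S.one_dim[OF i split_vector_top[OF v i]] by blast
  let ?z = "w - smul c (split_vector v i)"
  have "act (Es i) ?z = 0"
    by (simp add: A.act_diff_right A.act_smul[of "Es i"] c)
  then have "below i ?z"
    by (intro below_Suc[of i ?z] below_diff below_smul w split_vector_below v)
  moreover have "above i ?z"
    by (intro above_diff above_smul w split_vector_above)
  ultimately have "?z = 0"
    by (intro flags_opposite[of i i]) simp_all
  then show ?thesis by (intro exI[of _ c]) simp
qed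

text \<open>
  By the two shift lemmas \<open>(A\<^sup>* - \<theta>\<^sup>*\<^bsub>k+1\<^esub>) u\<^bsub>k+1\<^esub>\<close> lies in \<open>U\<^sub>k\<close>, so it is a multiple
  of \<open>u\<^sub>k\<close>. Applying \<open>A - \<theta>\<^sub>k\<close> identifies the factor with the eigenvalue, which may be
  tested on any nonzero vector \<open>w\<close> of \<open>U\<^bsub>k+1\<^esub>\<close> because this space is a line.
\<close>

lemma split_vector_lowering:
  assumes v: "act (Es 0) v = v" "v \<noteq> 0" and k: "Suc k \<le> d"
    and w: "below (Suc (Suc k)) w" "above (Suc k) w" "w \<noteq> 0"
    and eig: "act ((A - scale (\<theta> k) 1) * (As - scale (\<theta>s (Suc k)) 1)) w = smul f w"
  shows "act (As - scale (\<theta>s (Suc k)) 1) (split_vector v (Suc k)) = smul f (split_vector v k)"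
proof -
  let ?u = "split_vector v"
  let ?T = "(A - scale (\<theta> k) 1) * (As - scale (\<theta>s (Suc k)) 1)"
  obtain c where c: "w = smul c (?u (Suc k))"
    using split_space_spanned[OF v k w(1,2)] by blast
  have "c \<noteq> 0" using c w(3) by auto
  have "smul c (act ?T (?u (Suc k))) = smul c (smul f (?u (Suc k)))"
    using eig unfolding c A.act_smul[of ?T] by (simp add: mult.commute)
  then have T: "act ?T (?u (Suc k)) = smul f (?u (Suc k))"
    using \<open>c \<noteq> 0\<close> A.V.scale_left_imp_eq by blast
  obtain b where b: "act (As - scale (\<theta>s (Suc k)) 1) (?u (Suc k)) = smul b (?u k)"
    using split_space_spanned[OF v, of k "act (As - scale (\<theta>s (Suc k)) 1) (?u (Suc k))"] k
      below_shift_star[OF split_vector_below[OF v(1)]] above_shift_star[OF split_vector_above]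
    by auto
  have "act (A - scale (\<theta> k) 1) (smul b (?u k)) = smul f (?u (Suc k))"
    using T unfolding A.act_mult b .
  then have "smul b (?u (Suc k)) = smul f (?u (Suc k))"
    unfolding A.act_smul[of "A - _"] split_vector_Suc[of v k, symmetric] .
  moreover have "?u (Suc k) \<noteq> 0"
    using split_vector_top[OF v k] by auto
  ultimately have "b = f"
    using A.V.scale_right_imp_eq by blast
  then show ?thesis using b by simp
qed

section \<open>Two words evaluated on split vectors\<close>

lemma split_vector_full: "split_vector v d = smul (\<Prod>j<d. \<theta> d - \<theta> j) (act (E d) v)"
  unfolding split_vector_def
proof (rule A.ladder_full)
  fix j assume "j \<le> d" "j \<noteq> d"
  then show "\<exists>k<d. \<theta> k = \<theta> j" by (intro exI[of _ j]) simp
qed simp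

text \<open>
  Modulo the higher spaces \<open>U\<^sub>j\<close>, each factor \<open>A\<^sup>* - c\<close> lowers by one step whatever \<open>c\<close>
  is, since changing \<open>c\<close> changes the result by a multiple of the vector itself. Thus the
  factors of \<open>\<tau>\<^sup>*\<^sub>d(A\<^sup>*)\<close> may be applied although their order does not match the
  \<open>\<theta>\<^sup>*\<^sub>j\<close> at which \<open>u\<^sub>d, u\<^bsub>d-1\<^esub>, \<dots>\<close> are lowered exactly.
\<close>

lemma descent:
  assumes low: "\<And>k. k < d \<Longrightarrow>
      act (As - scale (\<theta>s (Suc k)) 1) (split_vector v (Suc k)) = smul (\<phi> (Suc k)) (split_vector v k)"
    and k: "k \<le> d"
  shows "above (Suc d - k) (A.ladder As c (split_vector v d) k
    - smul (\<Prod>j<k. \<phi> (d - j)) (split_vector v (d - k)))"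
  using k
proof (induction k)
  case 0
  then show ?case by (simp add: above_def A.act_one)
next
  case (Suc k)
  define m where "m = d - Suc k"
  have m: "d - k = Suc m" "Suc d - k = Suc (Suc m)" "m < d"
    using Suc.prems by (auto simp: m_def)
  let ?u = "split_vector v"
  let ?P = "\<Prod>j<k. \<phi> (d - j)"
  let ?T = "As - scale (c k) 1"
  have step: "act ?T (?u (Suc m)) = smul (\<phi> (Suc m)) (?u m) + smul (\<theta>s (Suc m) - c k) (?u (Suc m))"
    using low[OF m(3)]
    by (simp add: A.act_diff_scalar A.V.scale_left_diff_distrib algebra_simps)
  have "A.ladder As c (?u d) (Suc k) - smul (\<Prod>j<Suc k. \<phi> (d - j)) (?u m)
      = act ?T (A.ladder As c (?u d) k - smul ?P (?u (Suc m)))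
        + smul ?P (smul (\<theta>s (Suc m) - c k) (?u (Suc m)))"
    unfolding A.act_diff_right A.act_smul[of ?T] step
    by (simp add: A.act_add_right m)
  also have "above (Suc m) \<dots>"
    using Suc by (intro above_add above_smul above_shift_star split_vector_above) (simp add: m)
  finally show ?case
    using m by (simp add: m_def[symmetric] Suc_diff_Suc)
qed

text \<open>
  The counterpart of \<open>descent\<close> for \<open>A\<close>, with leading coefficient \<open>1\<close> at every step.
\<close>

lemma ascent:
  assumes "act (Es 0) v = v"
  shows "below k (A.ladder A c v k - split_vector v k)"
proof (induction k)
  case 0
  then show ?case by (simp add: below_def)
next
  case (Suc k)
  let ?u = "split_vector v"
  have "A.ladder A c v (Suc k) - ?u (Suc k)
      = act (A - scale (c k) 1) (A.ladder A c v k - ?u k) + smul (\<theta> k - c k) (?u k)"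
    by (simp add: split_vector_Suc A.act_diff_scalar A.act_diff_right A.V.scale_left_diff_distrib algebra_simps)
  also have "below (Suc k) \<dots>"
    by (intro below_add below_smul below_shift Suc split_vector_below assms)
  finally show ?case .
qed

lemma prod_diff_nonzero:
  assumes "inj_on f {..d}"
  shows "(\<Prod>j<d. f d - f j) \<noteq> (0::'k)" "(\<Prod>j<d. f 0 - f (d - j)) \<noteq> (0::'k)"
proof -
  show "(\<Prod>j<d. f d - f j) \<noteq> 0"
    using inj_onD[OF assms, of d] by fastforce
  show "(\<Prod>j<d. f 0 - f (d - j)) \<noteq> 0"
    using inj_onD[OF assms, of 0] by fastforce
qed

lemma prod_reverse: "(\<Prod>j<d. f (d - j)) = (\<Prod>i=1..d. f i)" for f :: "nat \<Rightarrow> 'k"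
  by (rule prod.reindex_bij_witness[of _ "\<lambda>i. d - i" "\<lambda>j. d - j"]) auto

text \<open>
  Up to scalars \<open>E\<^sub>d v\<close> is \<open>u\<^sub>d\<close> and \<open>E\<^sup>*\<^sub>d u\<^sub>d\<close> is \<open>\<tau>\<^sup>*\<^sub>d(A\<^sup>*) u\<^sub>d\<close>, which \<open>descent\<close>
  compares with \<open>u\<^sub>0\<close>; the difference is killed by \<open>E\<^sub>0\<close>.
\<close>

lemma word_from_bottom:
  assumes low: "\<And>k. k < d \<Longrightarrow>
      act (As - scale (\<theta>s (Suc k)) 1) (split_vector v (Suc k)) = smul (\<phi> (Suc k)) (split_vector v k)"
  shows "act (E 0) (act (Es d) (act (E d) v))
    = smul ((\<Prod>i=1..d. \<phi> i) / ((\<Prod>j<d. \<theta> d - \<theta> j) * (\<Prod>j<d. \<theta>s d - \<theta>s j))) (act (E 0) v)"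
proof -
  let ?t = "\<Prod>j<d. \<theta> d - \<theta> j" and ?ts = "\<Prod>j<d. \<theta>s d - \<theta>s j" and ?p = "\<Prod>i=1..d. \<phi> i"
  have nz: "?t \<noteq> 0" "?ts \<noteq> 0"
    by (rule prod_diff_nonzero A.inj S.inj)+
  have "smul (?t * ?ts) (act (E 0) (act (Es d) (act (E d) v)))
      = act (E 0) (smul ?ts (act (Es d) (split_vector v d)))"
    unfolding split_vector_full A.act_smul[of "Es d"] A.act_smul[of "E 0"]
    by (simp add: mult.commute)
  also have "smul ?ts (act (Es d) (split_vector v d)) = A.ladder As \<theta>s (split_vector v d) d"
  proof (rule S.ladder_full[symmetric])
    fix j assume "j \<le> d" "j \<noteq> d"
    then show "\<exists>k<d. \<theta>s k = \<theta>s j" by (intro exI[of _ j]) simp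
  qed simp
  also have "act (E 0) \<dots> = smul ?p (act (E 0) v)"
    using descent[where v = v and \<phi> = \<phi> and k = d and c = \<theta>s, OF low] prod_reverse[of \<phi>]
    by (simp add: above_def A.act_diff_right A.act_smul[of "E 0"])
  finally have eq: "smul (?t * ?ts) (act (E 0) (act (Es d) (act (E d) v))) = smul ?p (act (E 0) v)" .
  show ?thesis
    by (rule A.smul_eq_divide[OF _ eq]) (use nz in simp)
qed

text \<open>
  Here the first part is exact: applying \<open>E\<^sup>*\<^sub>0\<close> to
  \<open>(A\<^sup>* - \<theta>\<^sup>*\<^sub>k) u\<^sub>k = \<phi>\<^sub>k u\<^bsub>k-1\<^esub>\<close> gives a recursion for \<open>E\<^sup>*\<^sub>0 u\<^sub>k\<close>. Then
  \<open>E\<^sub>0 v\<close> is \<open>\<eta>\<^sub>d(A) v\<close> up to a scalar, which \<open>ascent\<close> compares with \<open>u\<^sub>d\<close>; the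
  difference is killed by \<open>E\<^sup>*\<^sub>d\<close>.
\<close>

lemma word_from_top:
  assumes v: "act (Es 0) v = v"
    and low: "\<And>k. k < d \<Longrightarrow>
      act (As - scale (\<theta>s (Suc k)) 1) (split_vector v (Suc k)) = smul (\<phi> (Suc k)) (split_vector v k)"
  shows "act (Es d) (act (E 0) (act (Es 0) (split_vector v d)))
    = smul ((\<Prod>i=1..d. \<phi> i) / ((\<Prod>j<d. \<theta> 0 - \<theta> (d - j)) * (\<Prod>j<d. \<theta>s 0 - \<theta>s (d - j))))
        (act (Es d) (split_vector v d))"
proof -
  let ?u = "split_vector v"
  let ?t = "\<Prod>j<d. \<theta> 0 - \<theta> (d - j)" and ?ts = "\<Prod>j<d. \<theta>s 0 - \<theta>s (d - j)"
    and ?p = "\<Prod>i=1..d. \<phi> i"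
  have nz: "?t \<noteq> 0" "?ts \<noteq> 0"
    by (rule prod_diff_nonzero A.inj S.inj)+
  have "smul (\<Prod>i=1..k. \<theta>s 0 - \<theta>s i) (act (Es 0) (?u k)) = smul (\<Prod>i=1..k. \<phi> i) v" if "k \<le> d" for k
    using that
  proof (induction k)
    case 0
    then show ?case using v by simp
  next
    case (Suc k)
    have "smul (\<theta>s 0 - \<theta>s (Suc k)) (act (Es 0) (?u (Suc k))) = smul (\<phi> (Suc k)) (act (Es 0) (?u k))"
      using low[of k] Suc.prems S.proj_shift[of 0 "\<theta>s (Suc k)" "?u (Suc k)"]
      by (simp add: A.act_smul[of "Es 0"])
    then have "smul (\<Prod>i=1..k. \<theta>s 0 - \<theta>s i) (smul (\<theta>s 0 - \<theta>s (Suc k)) (act (Es 0) (?u (Suc k))))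
        = smul (\<phi> (Suc k)) (smul (\<Prod>i=1..k. \<theta>s 0 - \<theta>s i) (act (Es 0) (?u k)))"
      by (simp only: A.V.scale_left_commute)
    also have "\<dots> = smul (\<phi> (Suc k)) (smul (\<Prod>i=1..k. \<phi> i) v)"
      using Suc by simp
    finally show ?case by (simp add: mult.commute)
  qed
  from this[of d] have Es0: "smul ?ts (act (Es 0) (?u d)) = smul ?p v"
    by (simp add: prod_reverse[of "\<lambda>i. \<theta>s 0 - \<theta>s i"])
  have "smul (?t * ?ts) (act (Es d) (act (E 0) (act (Es 0) (?u d))))
      = act (Es d) (smul ?t (act (E 0) (smul ?ts (act (Es 0) (?u d)))))"
    unfolding A.act_smul[of "Es d"] A.act_smul[of "E 0"] by simp
  also have "\<dots> = smul ?p (act (Es d) (smul ?t (act (E 0) v)))"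
    unfolding Es0 A.act_smul[of "Es d"] A.act_smul[of "E 0"] by (simp add: mult.commute)
  also have "smul ?t (act (E 0) v) = A.ladder A (\<lambda>j. \<theta> (d - j)) v d"
  proof (rule A.ladder_full[symmetric])
    fix j assume "j \<le> d" "j \<noteq> 0"
    then show "\<exists>k<d. \<theta> (d - k) = \<theta> j" by (intro exI[of _ "d - j"]) simp
  qed simp
  also have "act (Es d) \<dots> = act (Es d) (?u d)"
    using ascent[OF v, of d] by (simp add: below_def A.act_diff_right)
  finally have eq: "smul (?t * ?ts) (act (Es d) (act (E 0) (act (Es 0) (?u d))))
      = smul ?p (act (Es d) (?u d))" .
  show ?thesis
    by (rule A.smul_eq_divide[OF _ eq]) (use nz in simp)
qed

section \<open>The form that makes a Leonard pair selfadjoint\<close>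

text \<open>
  In a basis of eigenvectors \<open>y\<^sub>i\<close> of \<open>A\<^sup>*\<close> with matrix entries \<open>a\<^bsub>ij\<^esub>\<close> of \<open>A\<close>, the form
  \<open>B(y\<^sub>i, y\<^sub>j) = \<delta>\<^bsub>ij\<^esub> k\<^sub>i\<close> makes \<open>A\<close> selfadjoint iff \<open>k\<^sub>i a\<^bsub>ij\<^esub> = k\<^sub>j a\<^bsub>ji\<^esub>\<close>. For a
  tridiagonal matrix this is a recursion for \<open>k\<close>, solvable with nonzero \<open>k\<^sub>i\<close> because the
  entries next to the diagonal do not vanish.
\<close>

lemma ex_symmetrizing_form:
  "\<exists>B. nondegenerate_form scale act B \<and> bilinear_form.selfadjoint act B A
    \<and> bilinear_form.selfadjoint act B As"
proof -
  have "\<exists>y. act (Es i) y = y \<and> y \<noteq> 0" if i: "i \<le> d" for i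
    using S.nonzero[OF i] S.orth[OF i i] by auto
  then obtain y where y: "\<And>i. i \<le> d \<Longrightarrow> act (Es i) (y i) = y i" "\<And>i. i \<le> d \<Longrightarrow> y i \<noteq> 0"
    by metis
  have "\<exists>c. act (Es i) v = smul c (y i)" if i: "i \<le> d" for i v
    using S.one_dim[OF i, of "y i" v] y[OF i] by simp
  then obtain g where g: "\<And>i v. i \<le> d \<Longrightarrow> act (Es i) v = smul (g i v) (y i)"
    by metis
  \<comment> \<open>\<open>g i v\<close> is the \<open>i\<close>-th coordinate of \<open>v\<close> in the basis \<open>y\<close>\<close>
  have gI: "g i v = c" if "i \<le> d" "act (Es i) v = smul c (y i)" for i v c
    using that g[OF that(1), of v] y(2)[OF that(1)] A.V.scale_right_imp_eq by metis
  have g_add: "g i (v + w) = g i v + g i w" if i: "i \<le> d" for i v w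
    by (rule gI[OF i]) (simp only: A.act_add_right g[OF i] A.V.scale_left_distrib)
  have g_smul: "g i (smul c v) = c * g i v" if i: "i \<le> d" for i c v
    by (rule gI[OF i]) (unfold A.act_smul[of "Es i"], unfold g[OF i], rule A.V.scale_scale)
  have g_As: "g i (act As v) = \<theta>s i * g i v" if i: "i \<le> d" for i v
    by (rule gI[OF i]) (unfold S.eig_right[OF i], unfold g[OF i], rule A.V.scale_scale)
  define a where "a i j = g i (act A (y j))" for i j
  have a: "act (Es i) (act A (y j)) = smul (a i j) (y i)" if "i \<le> d" for i j
    unfolding a_def by (rule g[OF that])
  have g_A: "g i (act A v) = (\<Sum>j\<le>d. a i j * g j v)" if i: "i \<le> d" for i v
  proof (rule gI[OF i])
    have "act (Es i) (act A v) = (\<Sum>j\<le>d. act (Es i) (act A (act (Es j) v)))"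
      by (rule proj_A)
    also have "\<dots> = (\<Sum>j\<le>d. smul (a i j * g j v) (y i))"
    proof (rule sum.cong)
      fix j assume "j \<in> {..d}"
      then have "act (Es i) (act A (act (Es j) v)) = smul (g j v) (act (Es i) (act A (y j)))"
        by (simp only: g atMost_iff A.act_smul[of A] A.act_smul[of "Es i"])
      then show "act (Es i) (act A (act (Es j) v)) = smul (a i j * g j v) (y i)"
        by (simp only: a[OF i] A.V.scale_scale mult.commute)
    qed simp
    finally show "act (Es i) (act A v) = smul (\<Sum>j\<le>d. a i j * g j v) (y i)"
      unfolding A.V.scale_sum_left .
  qed
  have a_zero: "a i j = 0" if "i \<le> d" "j \<le> d" "Suc i < j \<or> Suc j < i" for i j
    unfolding a_def using A_zero[OF that, of "y j"] y(1)[OF that(2)] that(1) by (intro gI) simp_all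
  have a_nonzero: "a i j \<noteq> 0" if "i \<le> d" "j \<le> d" "i = Suc j \<or> j = Suc i" for i j
    using A_nonzero[OF that, of "y j"] y[OF that(2)] a[OF that(1), of j] by auto
  define k where "k i = (\<Prod>j<i. a j (Suc j) / a (Suc j) j)" for i
  have k_Suc: "k (Suc i) * a (Suc i) i = k i * a i (Suc i)" if "Suc i \<le> d" for i
    using a_nonzero[of "Suc i" i] that by (simp add: k_def)
  have k_nonzero: "k i \<noteq> 0" if "i \<le> d" for i
    using that a_nonzero by (auto simp: k_def)
  have sym: "k i * a i j = k j * a j i" if ij: "i \<le> d" "j \<le> d" for i j
  proof -
    consider "Suc i < j \<or> Suc j < i" | "i = j" | "i = Suc j" | "j = Suc i" by linarith
    then show ?thesis
    proof cases
      case 1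
      then show ?thesis using a_zero[of i j] a_zero[of j i] ij by auto
    qed (use k_Suc ij in auto)
  qed
  define B where "B v w = (\<Sum>i\<le>d. k i * g i v * g i w)" for v w
  interpret B: bilinear_form scale act B
    by unfold_locales
      (simp_all add: B_def g_add g_smul distrib_left distrib_right sum.distrib sum_distrib_left
        mult.assoc mult.left_commute)
  have "nondegenerate_form scale act B"
  proof
    fix v assume v: "\<And>w. B v w = 0"
    show "v = 0"
    proof (rule S.eqI_proj)
      fix i assume i: "i \<le> d"
      have "g j (y i) = (if j = i then 1 else 0)" if "j \<le> d" for j
        using S.orth[OF that i, of "y i"] y(1)[OF i] by (intro gI[OF that]) (auto simp: A.act_one)
      then have "B v (y i) = (\<Sum>j\<le>d. if j = i then k i * g i v else 0)"
        unfolding B_def by (intro sum.cong) auto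
      then have "k i * g i v = 0"
        using v[of "y i"] i by simp
      then show "act (Es i) v = act (Es i) 0"
        using k_nonzero[OF i] by (simp add: g[OF i])
    qed
  qed
  moreover have "B.selfadjoint As"
    unfolding B.selfadjoint_def B_def by (intro allI sum.cong) (simp_all add: g_As mult.left_commute)
  moreover have "B.selfadjoint A"
    unfolding B.selfadjoint_def
  proof (intro allI)
    fix v w
    have "B (act A v) w = (\<Sum>i\<le>d. \<Sum>j\<le>d. k i * a i j * (g j v * g i w))"
      unfolding B_def by (intro sum.cong) (simp_all add: g_A sum_distrib_left sum_distrib_right ac_simps)
    also have "\<dots> = (\<Sum>j\<le>d. \<Sum>i\<le>d. k i * a i j * (g j v * g i w))"
      by (rule sum.swap)
    also have "\<dots> = (\<Sum>j\<le>d. \<Sum>i\<le>d. k j * a j i * (g j v * g i w))"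
      by (intro sum.cong refl) (simp add: sym)
    also have "\<dots> = B v (act A w)"
      unfolding B_def by (intro sum.cong) (simp_all add: g_A sum_distrib_left sum_distrib_right ac_simps)
    finally show "B (act A v) w = B v (act A w)" .
  qed
  ultimately show ?thesis by blast
qed

lemma reverse_idempotent_word:
  assumes "P \<in> E ` {..d} \<union> Es ` {..d}" "Q \<in> E ` {..d} \<union> Es ` {..d}"
    "R \<in> E ` {..d} \<union> Es ` {..d}" "T \<in> E ` {..d} \<union> Es ` {..d}"
    and eq: "P * Q * R * T = scale c (P * T)"
  shows "T * R * Q * P = scale c (T * P)"
proof -
  obtain B where B: "nondegenerate_form scale act B"
    and adj: "bilinear_form.selfadjoint act B A" "bilinear_form.selfadjoint act B As"
    using ex_symmetrizing_form by blast
  interpret B: nondegenerate_form scale act B by fact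
  have "B.selfadjoint x" if "x \<in> E ` {..d} \<union> Es ` {..d}" for x
    using that B.selfadjoint_idempotent[OF A.spectral_family_axioms adj(1)]
      B.selfadjoint_idempotent[OF S.spectral_family_axioms adj(2)] by auto
  then show ?thesis
    using assms(1-4) by (intro B.reverse_word[OF _ _ _ _ eq])
qed

section \<open>From Leonard systems to the words\<close>

text \<open>
  The link between sums of ranges of idempotents and vanishing components, by
  orthogonality of the idempotents.
\<close>

lemma split_space_flags:
  assumes i: "i \<le> d" and v: "v \<in> split_space act d E Es i"
  shows "below (Suc i) v" "above i v"
proof -
  obtain s where s: "v = sum s {0..i}" "\<And>j. j \<in> {0..i} \<Longrightarrow> s j \<in> range (act (Es j))"
    using v unfolding split_space_def set_sum_alt[OF finite_atLeastAtMost] by blast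
  have "act (Es k) (s j) = 0" if "k \<le> d" "Suc i \<le> k" "j \<in> {0..i}" for k j
    using s(2)[OF that(3)] S.orth[of k j] that i by auto
  then show "below (Suc i) v"
    unfolding below_def s(1) A.act_sum_right by (auto intro!: sum.neutral)
  obtain t where t: "v = sum t {i..d}" "\<And>j. j \<in> {i..d} \<Longrightarrow> t j \<in> range (act (E j))"
    using v unfolding split_space_def set_sum_alt[OF finite_atLeastAtMost] by blast
  have "act (E k) (t j) = 0" if "k < i" "j \<in> {i..d}" for k j
    using t(2)[OF that(2)] A.orth[of k j] that i by auto
  then show "above i v"
    unfolding above_def t(1) A.act_sum_right by (auto intro!: sum.neutral)
qed

lemma first_split_sequence_lowering:
  assumes \<phi>: "first_split_sequence scale act d A E As Es \<theta> \<theta>s \<phi>"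
    and v: "act (Es 0) v = v" "v \<noteq> 0" and k: "k < d"
  shows "act (As - scale (\<theta>s (Suc k)) 1) (split_vector v (Suc k)) = smul (\<phi> (Suc k)) (split_vector v k)"
proof -
  have "Suc k \<in> {1..d}" using k by simp
  then obtain w where w: "w \<in> split_space act d E Es (Suc k)" "w \<noteq> 0"
    and eig: "act ((A - scale (\<theta> (Suc k - 1)) 1) * (As - scale (\<theta>s (Suc k)) 1)) w = smul (\<phi> (Suc k)) w"
    using \<phi> unfolding first_split_sequence_def eigenvalue_on_def by blast
  show ?thesis
    using split_space_flags[OF _ w(1)] w(2) eig k by (intro split_vector_lowering[OF v, of k w]) simp_all
qed

lemma extreme_idempotent_words:
  assumes \<phi>: "first_split_sequence scale act d A E As Es \<theta> \<theta>s \<phi>"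
  shows "E 0 * Es d * E d * Es 0 =
      scale ((\<Prod>i=1..d. \<phi> i) / ((\<Prod>j<d. \<theta> d - \<theta> j) * (\<Prod>j<d. \<theta>s d - \<theta>s j))) (E 0 * Es 0)" (is ?bottom)
    and "Es d * E 0 * Es 0 * E d =
      scale ((\<Prod>i=1..d. \<phi> i) / ((\<Prod>j<d. \<theta> 0 - \<theta> (d - j)) * (\<Prod>j<d. \<theta>s 0 - \<theta>s (d - j)))) (Es d * E d)" (is ?top)
    and "Es 0 * E d * Es d * E 0 =
      scale ((\<Prod>i=1..d. \<phi> i) / ((\<Prod>j<d. \<theta> d - \<theta> j) * (\<Prod>j<d. \<theta>s d - \<theta>s j))) (Es 0 * E 0)"
    and "E d * Es 0 * E 0 * Es d =
      scale ((\<Prod>i=1..d. \<phi> i) / ((\<Prod>j<d. \<theta> 0 - \<theta> (d - j)) * (\<Prod>j<d. \<theta>s 0 - \<theta>s (d - j)))) (E d * Es d)"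
proof -
  show bottom: ?bottom
  proof (rule A.eqI_act)
    fix w
    let ?v = "act (Es 0) w" and ?c = "(\<Prod>i=1..d. \<phi> i) / ((\<Prod>j<d. \<theta> d - \<theta> j) * (\<Prod>j<d. \<theta>s d - \<theta>s j))"
    have v: "act (Es 0) ?v = ?v"
      using S.orth[of 0 0 w] by simp
    have "act (E 0) (act (Es d) (act (E d) ?v)) = smul ?c (act (E 0) ?v)"
    proof (cases "?v = 0")
      case False
      show ?thesis
        by (rule word_from_bottom[OF first_split_sequence_lowering[OF \<phi> v False]])
    qed simp
    then show "act (E 0 * Es d * E d * Es 0) w = act (scale ?c (E 0 * Es 0)) w"
      unfolding A.act_scale[of _ "E 0 * Es 0"] A.act_mult .
  qed
  show top: ?top
  proof (rule A.eqI_act)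
    fix w
    let ?c = "(\<Prod>i=1..d. \<phi> i) / ((\<Prod>j<d. \<theta> 0 - \<theta> (d - j)) * (\<Prod>j<d. \<theta>s 0 - \<theta>s (d - j)))"
    obtain v' where v': "act (Es 0) v' \<noteq> 0"
      using S.nonzero[of 0] by blast
    define v where "v = act (Es 0) v'"
    have v: "act (Es 0) v = v" "v \<noteq> 0"
      using S.orth[of 0 0 v'] v' by (simp_all add: v_def)
    have u: "split_vector v d = act (E d) (smul (\<Prod>j<d. \<theta> d - \<theta> j) v)"
      unfolding split_vector_full A.act_smul[of "E d"] ..
    have "act (E d) (smul (\<Prod>j<d. \<theta> d - \<theta> j) v) \<noteq> 0"
      using split_vector_top[OF v, of d] unfolding u by auto
    then obtain b where b: "act (E d) w = smul b (split_vector v d)"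
      using A.one_dim[of d "smul (\<Prod>j<d. \<theta> d - \<theta> j) v" w] unfolding u by auto
    have "act (Es d) (act (E 0) (act (Es 0) (split_vector v d))) = smul ?c (act (Es d) (split_vector v d))"
      by (rule word_from_top[OF v(1) first_split_sequence_lowering[OF \<phi> v]])
    then show "act (Es d * E 0 * Es 0 * E d) w = act (scale ?c (Es d * E d)) w"
      unfolding A.act_scale[of _ "Es d * E d"] A.act_mult b
      unfolding A.act_smul[of "Es d"] A.act_smul[of "E 0"] A.act_smul[of "Es 0"]
      by (simp only: A.V.scale_left_commute)
  qed
  show "Es 0 * E d * Es d * E 0 =
      scale ((\<Prod>i=1..d. \<phi> i) / ((\<Prod>j<d. \<theta> d - \<theta> j) * (\<Prod>j<d. \<theta>s d - \<theta>s j))) (Es 0 * E 0)"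
    by (rule reverse_idempotent_word[OF _ _ _ _ bottom]) auto
  show "E d * Es 0 * E 0 * Es d =
      scale ((\<Prod>i=1..d. \<phi> i) / ((\<Prod>j<d. \<theta> 0 - \<theta> (d - j)) * (\<Prod>j<d. \<theta>s 0 - \<theta>s (d - j)))) (E d * Es d)"
    by (rule reverse_idempotent_word[OF _ _ _ _ top]) auto
qed

end

lemma (in spectral_family) spectral_family_reverse:
  "spectral_family scale act d X (\<lambda>i. E (d - i)) (\<lambda>i. \<theta> (d - i))"
proof
  show "inj_on (\<lambda>i. \<theta> (d - i)) {..d}"
  proof (rule inj_onI)
    fix i j assume ij: "i \<in> {..d}" "j \<in> {..d}" "\<theta> (d - i) = \<theta> (d - j)"
    then have "d - i = d - j"
      by (intro inj_onD[OF inj]) auto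
    then show "i = j" using ij by auto
  qed
  show "(\<Sum>i\<le>d. act (E (d - i)) v) = v" for v
    using sum_one[of v] sum.nat_diff_reindex[of "\<lambda>i. act (E i) v" "Suc d"]
    by (simp add: lessThan_Suc_atMost)
  show "act (E (d - i)) (act (E (d - j)) v) = (if i = j then act (E (d - i)) v else 0)"
    if "i \<le> d" "j \<le> d" for i j v
    using orth[of "d - i" "d - j" v] that by auto
qed (use eig_left eig_right one_dim nonzero in \<open>auto\<close>)

text \<open>
  The tridiagonal conditions depend on \<open>i\<close> and \<open>j\<close> only through \<open>\<bar>i - j\<bar>\<close>, which
  \<open>i \<mapsto> d - i\<close> preserves.
\<close>

lemma (in leonard) leonard_reverse:
  "leonard scale act d A (\<lambda>i. E (d - i)) (\<lambda>i. \<theta> (d - i)) As Es \<theta>s"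
proof -
  interpret R: spectral_family scale act d A "\<lambda>i. E (d - i)" "\<lambda>i. \<theta> (d - i)"
    by (rule A.spectral_family_reverse)
  show ?thesis
  proof
    show "act (E (d - i)) (act As (act (E (d - j)) v)) = 0"
      if "i \<le> d" "j \<le> d" "Suc i < j \<or> Suc j < i" for i j v
      using that by (intro As_zero) auto
  qed (use A_zero A_nonzero in blast)+
qed

lemma (in simple_matrix_module) leonard:
  assumes sys: "leonard_system scale act d A E As Es"
    and E: "idempotent_ordering scale act d A E \<theta>"
    and Es: "idempotent_ordering scale act d As Es \<theta>s"
  shows "leonard scale act d A E \<theta> As Es \<theta>s"
proof -
  interpret A: spectral_family scale act d A E \<theta> by (rule spectral_family[OF E])
  interpret S: spectral_family scale act d As Es \<theta>s by (rule spectral_family[OF Es])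
  have far: "\<bar>int i - int j\<bar> > 1" if "Suc i < j \<or> Suc j < i" for i j
    using that by linarith
  have near: "\<bar>int i - int j\<bar> = 1" if "i = Suc j \<or> j = Suc i" for i j
    using that by auto
  show ?thesis
  proof
    fix i j v assume ij: "i \<le> d" "j \<le> d"
    {
      assume "Suc i < j \<or> Suc j < i"
      then have "E i * (As * E j) = 0" "Es i * (A * Es j) = 0"
        using sys ij far unfolding leonard_system_def mult.assoc by blast+
      then show "act (E i) (act As (act (E j) v)) = 0" "act (Es i) (act A (act (Es j) v)) = 0"
        by (simp_all add: act_mult[symmetric])
    next
      assume near_ij: "i = Suc j \<or> j = Suc i" and v: "act (Es j) v \<noteq> 0"
      show "act (Es i) (act A (act (Es j) v)) \<noteq> 0"
      proof
        assume zero: "act (Es i) (act A (act (Es j) v)) = 0"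
        have "Es i * A * Es j = 0"
        proof (rule faithful)
          fix w
          obtain c where "act (Es j) w = smul c (act (Es j) v)"
            using S.one_dim[OF ij(2) v] by blast
          then have "act (Es i * A * Es j) w = smul c (act (Es i) (act A (act (Es j) v)))"
            by (simp only: act_mult act_smul[of A] act_smul[of "Es i"])
          then show "act (Es i * A * Es j) w = 0"
            using zero by simp
        qed
        then show False
          using sys ij near[OF near_ij] unfolding leonard_system_def by blast
      qed
    }
  qed
qed

section \<open>The eight identities\<close>

lemma poly_tau: "poly (tau \<theta> k) x = (\<Prod>j<k. x - \<theta> j)"
  by (simp add: tau_def poly_prod)

lemma poly_eta: "poly (eta d \<theta> k) x = (\<Prod>j<k. x - \<theta> (d - j))"
  by (simp add: eta_def poly_prod)

theorem theorem5p6: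
  fixes scale :: "'k::field \<Rightarrow> 'a::ring_1 \<Rightarrow> 'a"
    and act :: "'a \<Rightarrow> 'v::ab_group_add \<Rightarrow> 'v"
    and d :: nat
    and A As :: 'a and E Es :: "nat \<Rightarrow> 'a"
    and \<theta> \<theta>s \<phi>1 \<phi>2 :: "nat \<Rightarrow> 'k"
  assumes "full_matrix_algebra scale d"
    and "simple_left_module act"
    and "leonard_system scale act d A E As Es"
    and "parameter_array scale act d A E As Es \<theta> \<theta>s \<phi>1 \<phi>2"
  shows
    "E 0 * Es d * E d * Es 0 =
       scale ((\<Prod>i=1..d. \<phi>1 i) / (poly (tau \<theta> d) (\<theta> d) * poly (tau \<theta>s d) (\<theta>s d))) (E 0 * Es 0)
     \<and> E 0 * Es 0 * E d * Es d =
       scale ((\<Prod>i=1..d. \<phi>2 i) / (poly (tau \<theta> d) (\<theta> d) * poly (eta d \<theta>s d) (\<theta>s 0))) (E 0 * Es d)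
     \<and> E d * Es d * E 0 * Es 0 =
       scale ((\<Prod>i=1..d. \<phi>2 i) / (poly (eta d \<theta> d) (\<theta> 0) * poly (tau \<theta>s d) (\<theta>s d))) (E d * Es 0)
     \<and> E d * Es 0 * E 0 * Es d =
       scale ((\<Prod>i=1..d. \<phi>1 i) / (poly (eta d \<theta> d) (\<theta> 0) * poly (eta d \<theta>s d) (\<theta>s 0))) (E d * Es d)
     \<and> Es 0 * E d * Es d * E 0 =
       scale ((\<Prod>i=1..d. \<phi>1 i) / (poly (tau \<theta> d) (\<theta> d) * poly (tau \<theta>s d) (\<theta>s d))) (Es 0 * E 0)
     \<and> Es 0 * E 0 * Es d * E d =
       scale ((\<Prod>i=1..d. \<phi>2 i) / (poly (eta d \<theta> d) (\<theta> 0) * poly (tau \<theta>s d) (\<theta>s d))) (Es 0 * E d)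
     \<and> Es d * E d * Es 0 * E 0 =
       scale ((\<Prod>i=1..d. \<phi>2 i) / (poly (tau \<theta> d) (\<theta> d) * poly (eta d \<theta>s d) (\<theta>s 0))) (Es d * E 0)
     \<and> Es d * E 0 * Es 0 * E d =
       scale ((\<Prod>i=1..d. \<phi>1 i) / (poly (eta d \<theta> d) (\<theta> 0) * poly (eta d \<theta>s d) (\<theta>s 0))) (Es d * E d)"
proof -
  interpret simple_matrix_module scale d act
    using assms(1,2) by (rule simple_matrix_module.intro)
  have E: "idempotent_ordering scale act d A E \<theta>"
    and Es: "idempotent_ordering scale act d As Es \<theta>s"
    and \<phi>1: "first_split_sequence scale act d A E As Es \<theta> \<theta>s \<phi>1"
    and \<phi>2: "first_split_sequence scale act d A (\<lambda>i. E (d - i)) As Es (\<lambda>i. \<theta> (d - i)) \<theta>s \<phi>2"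
    using assms(4) by (simp_all add: parameter_array_def second_split_sequence_def)
  interpret L: leonard scale act d A E \<theta> As Es \<theta>s
    by (rule leonard[OF assms(3) E Es])
  interpret R: leonard scale act d A "\<lambda>i. E (d - i)" "\<lambda>i. \<theta> (d - i)" As Es \<theta>s
    by (rule L.leonard_reverse)
  \<comment> \<open>For the reversed system \<open>\<eta>\<^sub>d(\<theta>\<^sub>0)\<close> is \<open>\<tau>\<^sub>d(\<theta>\<^sub>d)\<close> of the given one.\<close>
  have "(\<Prod>j<d. \<theta> d - \<theta> (d - (d - j))) = (\<Prod>j<d. \<theta> d - \<theta> j)"
    by (intro prod.cong) auto
  with R.extreme_idempotent_words[OF \<phi>2] L.extreme_idempotent_words[OF \<phi>1] show ?thesis
    unfolding poly_tau poly_eta by simp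
qed

end
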